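(* The primitive permutation group $\mathrm{P}\Gamma\mathrm{L}(2,9)$ of degree $45$, acting as the automorphism group of the line graph of the Tutte--Coxeter graph (on the $45$ edges of that graph), fails to synchronize some non-uniform map of rank $5$ with kernel type $(5,5,10,10,15)$.
   Context: The Tutte--Coxeter graph is the cubic graph on $30$ vertices that is the incidence graph of points and lines of the generalized quadrangle $W(2)$ of order $2$ (15 points, 15 lines). The line graph of a graph has the edges of the graph as vertices, two being adjacent when they share an endpoint. A permutation group $G$ on $\Omega$ is primitive if it is transitive and preserves no equivalence relation on $\Omega$ other than equality and the universal relation. The rank of a map $f:\Omega\to\Omega$ is the size of its image; its kernel is the partition of $\Omega$ into the non-empty fibres of $f$; its kernel type lists the sizes of the kernel classes; $f$ is non-uniform if these sizes are not all equal. $G$ synchronizes $f$ if the transformation semigroup $\langle G,f\rangle$ contains a constant map. *)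

theory Defs
  imports
    "HOL-Analysis.Analysis"
    "HOL-Algebra.Coset"
    "HOL-Combinatorics.Permutations"
    "HOL-Library.Multiset"
    "HOL-Library.Numeral_Type"
    "HOL-Library.Z2"
begin

text \<open>A simple graph is a pair of a vertex set and a set of two-element sets of vertices.\<close>

type_synonym 'a sgraph = "'a set \<times> 'a set set"

abbreviation sverts :: "'a sgraph \<Rightarrow> 'a set" where "sverts \<equiv> fst"
abbreviation sedges :: "'a sgraph \<Rightarrow> 'a set set" where "sedges \<equiv> snd"

definition line_graph :: "'a sgraph \<Rightarrow> 'a set sgraph" where
  "line_graph \<Gamma> =
     (sedges \<Gamma>, {{e, e'} | e e'. e \<in> sedges \<Gamma> \<and> e' \<in> sedges \<Gamma> \<and> e \<noteq> e' \<and> e \<inter> e' \<noteq> {}})"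

definition graph_aut :: "'a sgraph \<Rightarrow> ('a \<Rightarrow> 'a) set" where
  "graph_aut \<Gamma> = {p. p permutes sverts \<Gamma> \<and>
     (\<forall>u \<in> sverts \<Gamma>. \<forall>v \<in> sverts \<Gamma>. {u, v} \<in> sedges \<Gamma> \<longleftrightarrow> {p u, p v} \<in> sedges \<Gamma>)}"

definition incidence_graph :: "'p set \<Rightarrow> 'l set \<Rightarrow> ('p \<Rightarrow> 'l \<Rightarrow> bool) \<Rightarrow> ('p + 'l) sgraph" where
  "incidence_graph P L I = (Inl ` P \<union> Inr ` L, {{Inl p, Inr l} | p l. p \<in> P \<and> l \<in> L \<and> I p l})"


text \<open>The symplectic quadrangle \<open>W(2)\<close>: all points of \<open>PG(3,2)\<close>, and the lines of \<open>PG(3,2)\<close> that are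
  totally isotropic for the standard symplectic form. In the index type \<open>4\<close> the numeral \<open>4\<close>
  denotes \<open>0\<close>, so the four coordinates below are distinct.\<close>

definition symp_form :: "bit ^ 4 \<Rightarrow> bit ^ 4 \<Rightarrow> bit" where
  "symp_form x y = x $ 1 * y $ 2 - x $ 2 * y $ 1 + (x $ 3 * y $ 4 - x $ 4 * y $ 3)"

definition W2_points :: "(bit ^ 4) set set" where
  "W2_points = {P. vec.subspace P \<and> vec.dim P = 1}"

definition W2_lines :: "(bit ^ 4) set set" where
  "W2_lines = {L. vec.subspace L \<and> vec.dim L = 2 \<and> (\<forall>x \<in> L. \<forall>y \<in> L. symp_form x y = 0)}"

definition Tutte_Coxeter :: "((bit ^ 4) set + (bit ^ 4) set) sgraph" where
  "Tutte_Coxeter = incidence_graph W2_points W2_lines (\<subseteq>)"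


definition perm_grp :: "('a \<Rightarrow> 'a) set \<Rightarrow> ('a \<Rightarrow> 'a) monoid" where
  "perm_grp G = \<lparr>carrier = G, mult = (\<circ>), one = id\<rparr>"

definition is_perm_group :: "'a set \<Rightarrow> ('a \<Rightarrow> 'a) set \<Rightarrow> bool" where
  "is_perm_group \<Omega> G \<longleftrightarrow> subgroup G (perm_grp {p. p permutes \<Omega>})"

definition transitive_group :: "'a set \<Rightarrow> ('a \<Rightarrow> 'a) set \<Rightarrow> bool" where
  "transitive_group \<Omega> G \<longleftrightarrow> (\<forall>x \<in> \<Omega>. \<forall>y \<in> \<Omega>. \<exists>g \<in> G. g x = y)"

definition preserves_rel :: "('a \<Rightarrow> 'a) set \<Rightarrow> 'a rel \<Rightarrow> bool" where
  "preserves_rel G R \<longleftrightarrow> (\<forall>g \<in> G. \<forall>(x, y) \<in> R. (g x, g y) \<in> R)"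

definition primitive_group :: "'a set \<Rightarrow> ('a \<Rightarrow> 'a) set \<Rightarrow> bool" where
  "primitive_group \<Omega> G \<longleftrightarrow> is_perm_group \<Omega> G \<and> transitive_group \<Omega> G \<and>
     (\<forall>R. equiv \<Omega> R \<and> preserves_rel G R \<longrightarrow> R = Id_on \<Omega> \<or> R = \<Omega> \<times> \<Omega>)"


text \<open>Maps on \<open>\<Omega>\<close> are total functions, of which only the values on \<open>\<Omega>\<close> are taken into account.\<close>

definition map_rank :: "'a set \<Rightarrow> ('a \<Rightarrow> 'a) \<Rightarrow> nat" where
  "map_rank \<Omega> f = card (f ` \<Omega>)"

definition map_kernel :: "'a set \<Rightarrow> ('a \<Rightarrow> 'a) \<Rightarrow> 'a set set" where
  "map_kernel \<Omega> f = {{x \<in> \<Omega>. f x = y} | y. y \<in> f ` \<Omega>}"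

definition kernel_type :: "'a set \<Rightarrow> ('a \<Rightarrow> 'a) \<Rightarrow> nat multiset" where
  "kernel_type \<Omega> f = image_mset card (mset_set (map_kernel \<Omega> f))"

definition non_uniform :: "'a set \<Rightarrow> ('a \<Rightarrow> 'a) \<Rightarrow> bool" where
  "non_uniform \<Omega> f \<longleftrightarrow> (\<exists>A \<in> map_kernel \<Omega> f. \<exists>B \<in> map_kernel \<Omega> f. card A \<noteq> card B)"

inductive_set semigroup_gen :: "('a \<Rightarrow> 'a) set \<Rightarrow> ('a \<Rightarrow> 'a) set" for S where
  gen: "s \<in> S \<Longrightarrow> s \<in> semigroup_gen S"
| comp: "s \<in> semigroup_gen S \<Longrightarrow> t \<in> semigroup_gen S \<Longrightarrow> s \<circ> t \<in> semigroup_gen S"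

definition synchronizes :: "'a set \<Rightarrow> ('a \<Rightarrow> 'a) set \<Rightarrow> ('a \<Rightarrow> 'a) \<Rightarrow> bool" where
  "synchronizes \<Omega> G f \<longleftrightarrow>
     (\<exists>t \<in> semigroup_gen (insert f G). \<exists>c \<in> \<Omega>. \<forall>x \<in> \<Omega>. t x = c)"


text \<open>\<open>P\<Gamma>L\<close>: the invertible semilinear maps modulo the nonzero scalars.\<close>

definition field_aut :: "('f::field \<Rightarrow> 'f) \<Rightarrow> bool" where
  "field_aut \<sigma> \<longleftrightarrow> bij \<sigma> \<and> \<sigma> 1 = 1 \<and>
     (\<forall>a b. \<sigma> (a + b) = \<sigma> a + \<sigma> b) \<and> (\<forall>a b. \<sigma> (a * b) = \<sigma> a * \<sigma> b)"

definition semilinear :: "('f::field \<Rightarrow> 'f) \<Rightarrow> ('f ^ 'n \<Rightarrow> 'f ^ 'n) \<Rightarrow> bool" where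
  "semilinear \<sigma> T \<longleftrightarrow>
     (\<forall>x y. T (x + y) = T x + T y) \<and> (\<forall>c x. T (c *s x) = \<sigma> c *s T x)"

definition GammaL :: "('f::field ^ 'n \<Rightarrow> 'f ^ 'n) monoid" where
  "GammaL = perm_grp {T. bij T \<and> (\<exists>\<sigma>. field_aut \<sigma> \<and> semilinear \<sigma> T)}"

definition scalar_maps :: "('f::field ^ 'n \<Rightarrow> 'f ^ 'n) set" where
  "scalar_maps = {(\<lambda>x. c *s x) | c. c \<noteq> 0}"

definition PGammaL :: "('f::field ^ 'n \<Rightarrow> 'f ^ 'n) set monoid" where
  "PGammaL = GammaL Mod scalar_maps"


text \<open>The field with nine elements, as \<open>\<F>\<^sub>3[i]\<close> with \<open>i\<^sup>2 = -1\<close>. Every nonzero element of \<open>\<F>\<^sub>3\<close> is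
  its own inverse, which gives the formula for \<^term>\<open>inverse\<close>.\<close>

datatype gf9 = GF9 (re9: "3") (im9: "3")

instantiation gf9 :: field
begin

definition "0 = GF9 0 0"
definition "1 = GF9 1 0"
definition "x + y = GF9 (re9 x + re9 y) (im9 x + im9 y)"
definition "- x = GF9 (- re9 x) (- im9 x)"
definition "x - y = GF9 (re9 x - re9 y) (im9 x - im9 y)"
definition "x * y = GF9 (re9 x * re9 y - im9 x * im9 y) (re9 x * im9 y + im9 x * re9 y)"
definition "inverse x =
  (let n = re9 x * re9 x + im9 x * im9 x in GF9 (n * re9 x) (- (n * im9 x)))"
definition "x div y = x * inverse (y :: gf9)"

instance
proof
  fix a b c :: gf9
  have all3: "z = 0 \<or> z = 1 \<or> z = 2" for z :: 3
  proof (cases z rule: bit1_cases)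
    case (of_int k)
    then have "k = 0 \<or> k = 1 \<or> k = 2" by auto
    then show ?thesis using of_int by auto
  qed
  note defs = zero_gf9_def one_gf9_def plus_gf9_def uminus_gf9_def minus_gf9_def
    times_gf9_def inverse_gf9_def divide_gf9_def
  show "a \<noteq> 0 \<Longrightarrow> inverse a * a = 1"
    using all3[of "re9 a"] all3[of "im9 a"]
    by (cases a) (auto simp: defs)
qed (simp_all add: zero_gf9_def one_gf9_def plus_gf9_def uminus_gf9_def minus_gf9_def
    times_gf9_def inverse_gf9_def divide_gf9_def algebra_simps gf9.expand)

end

lemma "card (UNIV :: gf9 set) = 9"
proof -
  have "bij_betw (\<lambda>(a, b). GF9 a b) (UNIV \<times> UNIV) UNIV"
    by (rule bij_betwI[where g = "\<lambda>x. (re9 x, im9 x)"]) auto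
  from bij_betw_same_card[OF this] show ?thesis
    by (simp add: card_cartesian_product)
qed

end

theory Submission
  imports Defs
begin

text \<open>
  The 45 edges of the Tutte-Coxeter graph are identified with the 45 unordered pairs of points of the
  projective line over the field with nine elements, in such a way that two edges share an endpoint
  exactly if the two pairs are harmonic conjugates, that is, have cross ratio \<open>-1\<close>. To find this
  identification, attach to each point \<open>p\<close> of the projective line a vector \<open>a\<^sub>p\<close> with
  \<open>Q(a\<^sub>p) = 0\<close>, where \<open>Q = x\<^sub>1x\<^sub>2 + x\<^sub>3x\<^sub>4\<close> polarizes to the symplectic form \<open>B\<close> of
  \<open>W(2)\<close>. The ten forms \<open>Q\<^sub>p(w) = Q(w) + B(a\<^sub>p, w)\<close>, which agree with \<open>Q + B(a\<^sub>p, -)\<^sup>2\<close>, are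
  the ten forms of plus type with polarization \<open>B\<close>. Two of them, \<open>Q\<^sub>p\<close> and \<open>Q\<^sub>q\<close>, agree exactly on
  the hyperplane orthogonal to \<open>v = a\<^sub>p + a\<^sub>q\<close>, and on one of the three totally isotropic lines through
  \<open>v\<close> they take the value 1 off \<open>v\<close>; the pair \<open>{p, q}\<close> corresponds to the flag formed by \<open>v\<close> and
  this line. For a suitable choice of the vectors \<open>a\<^sub>p\<close> (\<open>point_codes\<close>) this is an isomorphism of
  graphs, which is a finite verification (\<open>check_adj\<close>, \<open>flag_of_bij\<close>, \<open>adj_flag_of_pair\<close>).

  Semilinear maps preserve harmonic conjugacy, because they change determinants only by a field
  automorphism and a common factor. Hence \<open>P\<Gamma>L(2,9)\<close> acts on the graph, and there are no further
  automorphisms: two pairs have a common point exactly if they are at distance 3 in the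
  harmonic graph (\<open>meet_iff\<close>), so an automorphism preserves the relation of having a common point.
  It therefore maps the pairs through a point to the pairs through a point and
  is induced by a permutation of the ten points (\<open>pairs_whitney\<close>). This permutation preserves harmonic
  quadruples, and von Staudt's theorem says that it is induced by a semilinear map (\<open>von_Staudt\<close>). The maps
  that fix all points are the scalars, which gives the isomorphism with the quotient group.

  Primitivity follows from 3-transitivity on points (\<open>invariant_equivalence\<close>): an invariant
  equivalence that relates two different pairs relates two that share exactly one point, hence any two
  that share a point, hence any two.

  The map \<open>f\<close> is an endomorphism of the line graph. Its image is a butterfly, two triangles with one
  common vertex. Choose a proper colouring of the edges of the Tutte-Coxeter graph with three colours such that
  two of the colour classes form together a 10-cycle and a 20-cycle. The third colour class,
  which has 15 edges, goes to the common vertex; along the 10-cycle and the 20-cycle the edges go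
  alternately to the two other vertices of the first and of the second triangle. An endomorphism never maps two adjacent
  vertices to the same vertex, and the same holds for every product of endomorphisms
  and automorphisms, so no such product is constant.
\<close>

section \<open>The field with nine elements\<close>

lemmas gf9_defs = zero_gf9_def one_gf9_def plus_gf9_def uminus_gf9_def minus_gf9_def
  times_gf9_def

lemma three_exhaust: "z = 0 \<or> z = 1 \<or> z = 2" for z :: 3
proof (cases z rule: bit1_cases)
  case (of_int k)
  then have "k = 0 \<or> k = 1 \<or> k = 2" by auto
  then show ?thesis using of_int by auto
qed

lemma gf9_exhaust: "\<exists>a\<in>{0,1,2}. \<exists>b\<in>{0,1,2}. x = GF9 a b"
  using three_exhaust[of "re9 x"] three_exhaust[of "im9 x"] by (cases x) auto

instance gf9 :: finite
proof
  have "UNIV \<subseteq> (\<lambda>(a, b). GF9 a b) ` ({0,1,2} \<times> {0,1,2})"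
    using gf9_exhaust by fastforce
  then show "finite (UNIV :: gf9 set)"
    by (rule finite_subset) simp
qed

lemma gf9_double: "x + x = - x" for x :: gf9
  using gf9_exhaust[of x] by (auto simp: gf9_defs)

lemma gf9_neq_minus: "x \<noteq> - x" if "x \<noteq> 0" for x :: gf9
  using that gf9_exhaust[of x] by (auto simp: gf9_defs)

lemma gf9_root: "\<exists>a. a * a = u" if "u * u = -1" for u :: gf9
proof -
  have "u = GF9 0 1 \<or> u = GF9 0 2"
    using that gf9_exhaust[of u] by (auto simp: gf9_defs)
  moreover have "GF9 1 2 * GF9 1 2 = GF9 0 1" "GF9 1 1 * GF9 1 1 = GF9 0 2"
    by (auto simp: gf9_defs)
  ultimately show ?thesis by metis
qed

lemma gf9_squares: "a * a \<in> {1, - 1, GF9 0 1, GF9 0 2}" if "a \<noteq> 0" for a :: gf9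
  using that gf9_exhaust[of a] by (auto simp: gf9_defs)

text \<open>If \<open>u\<close> has order 8, the product below is nonzero only for \<open>a\<^sup>2 =
  -1\<close> and \<open>a\<^sup>2 = -u\<^sup>2\<close>, and then it is \<open>-1 - u\<^sup>2\<close> up to the
  factor \<open>u\<^sup>2\<close>. As \<open>u\<^sup>2\<close> is a square root of \<open>-1\<close>, this is
  a nonsquare. The lemma is the reason why certain quadratic equations in \<open>walk3_e0_disjoint\<close>
  have no solutions.\<close>

lemma gf9_nonsquare:
  fixes a u z :: gf9
  assumes "a \<noteq> 0" "u \<noteq> 0" "u \<noteq> 1" "u \<noteq> -1" "u * u \<noteq> -1"
    and z: "z * z = (a * a - 1) * (a * a - u * u)"
  shows "z = 0"
proof (rule ccontr)
  assume "z \<noteq> 0"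
  have "u * u \<noteq> 1" using assms(3,4) square_eq_1_iff[of u] by blast
  then have u: "u * u = GF9 0 1 \<or> u * u = GF9 0 2"
    using gf9_squares[OF assms(2)] assms(5) by auto
  have a: "a * a = GF9 1 0 \<or> a * a = GF9 2 0 \<or> a * a = GF9 0 1 \<or> a * a = GF9 0 2"
    using gf9_squares[OF assms(1)] by (auto simp: gf9_defs)
  have "z * z = GF9 0 0 \<or> z * z = GF9 1 1 \<or> z * z = GF9 1 2 \<or> z * z = GF9 2 1 \<or> z * z = GF9 2 2"
    using a u unfolding z by (elim disjE) (simp_all add: gf9_defs)
  then show False
    using gf9_squares[OF \<open>z \<noteq> 0\<close>] by (auto simp: gf9_defs)
qed

section \<open>The projective line and determinants\<close>

text \<open>\<open>None\<close> is the point at infinity; the coordinate vectors are normalized by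
  \<open>rep\<close>.\<close>

type_synonym pt = "gf9 option"

definition rep :: "pt \<Rightarrow> gf9 ^ 2" where
  "rep p = (case p of None \<Rightarrow> vector [1, 0] | Some x \<Rightarrow> vector [x, 1])"

definition point_of :: "gf9 ^ 2 \<Rightarrow> pt" where
  "point_of z = (if z $ 2 = 0 then None else Some (z $ 1 / z $ 2))"

definition det2 :: "gf9 ^ 2 \<Rightarrow> gf9 ^ 2 \<Rightarrow> gf9" where
  "det2 u v = u $ 1 * v $ 2 - u $ 2 * v $ 1"

lemma rep_nth [simp]: "rep None $ 1 = 1" "rep None $ 2 = 0" "rep (Some x) $ 1 = x" "rep (Some x) $ 2 = 1"
  by (simp_all add: rep_def)

lemma vec2_eq_iff: "u = v \<longleftrightarrow> u $ 1 = v $ 1 \<and> u $ 2 = v $ 2" for u v :: "'a ^ 2"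
  by (simp add: vec_eq_iff forall_2)

lemma point_of_rep [simp]: "point_of (rep p) = p"
  by (cases p) (simp_all add: point_of_def)

lemma rep_nonzero [simp]: "rep p \<noteq> 0"
  by (cases p) (simp_all add: vec2_eq_iff)

lemma rep_point_of: "\<exists>c. c \<noteq> 0 \<and> rep (point_of z) = c *s z" if "z \<noteq> 0"
proof (cases "z $ 2 = 0")
  case True
  then have "z $ 1 \<noteq> 0" using that by (simp add: vec2_eq_iff)
  then show ?thesis using True
    by (intro exI[of _ "1 / z $ 1"]) (simp add: point_of_def vec2_eq_iff)
next
  case False
  then show ?thesis
    by (intro exI[of _ "1 / z $ 2"]) (simp add: point_of_def vec2_eq_iff)
qed

lemma point_of_scale: "point_of (c *s z) = point_of z" if "c \<noteq> 0"
  using that by (simp add: point_of_def)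

lemma det2_rep_eq_0: "det2 (rep p) (rep q) = 0 \<longleftrightarrow> p = q"
  by (cases p; cases q) (simp_all add: det2_def)

lemma det2_scale: "det2 (a *s u) (b *s v) = a * b * det2 u v"
  by (simp add: det2_def algebra_simps)

section \<open>Semilinear maps\<close>

lemma field_autD:
  assumes "field_aut \<sigma>"
  shows "bij \<sigma>" "\<sigma> 1 = 1" "\<sigma> (a + b) = \<sigma> a + \<sigma> b" "\<sigma> (a * b) = \<sigma> a * \<sigma> b"
    "\<sigma> 0 = 0" "\<sigma> (a - b) = \<sigma> a - \<sigma> b" "\<sigma> a = \<sigma> b \<longleftrightarrow> a = b" "\<sigma> a = 0 \<longleftrightarrow> a = 0"
proof -
  show 1: "bij \<sigma>" "\<sigma> 1 = 1" "\<sigma> (a + b) = \<sigma> a + \<sigma> b" "\<sigma> (a * b) = \<sigma> a * \<sigma> b" for a b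
    using assms by (auto simp: field_aut_def)
  show 2: "\<sigma> 0 = 0" by (metis 1(3) add.right_neutral add_left_cancel)
  show "\<sigma> (a - b) = \<sigma> a - \<sigma> b"
    using 1(3)[of "a - b" b] by (simp add: algebra_simps)
  show 3: "\<sigma> a = \<sigma> b \<longleftrightarrow> a = b" for a b
    using 1(1) by (auto simp: bij_def inj_eq)
  show "\<sigma> a = 0 \<longleftrightarrow> a = 0" using 3[of a 0] 2 by simp
qed

text \<open>The semilinear map with companion automorphism \<open>\<sigma>\<close> that sends the standard
  basis to \<open>u\<close>, \<open>v\<close>.\<close>

definition semilin :: "(gf9 \<Rightarrow> gf9) \<Rightarrow> gf9 ^ 2 \<Rightarrow> gf9 ^ 2 \<Rightarrow> gf9 ^ 2 \<Rightarrow> gf9 ^ 2" where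
  "semilin \<sigma> u v z = \<sigma> (z $ 1) *s u + \<sigma> (z $ 2) *s v"

abbreviation \<Gamma> :: "(gf9 ^ 2 \<Rightarrow> gf9 ^ 2) set" where "\<Gamma> \<equiv> carrier GammaL"

lemma mem_Gamma: "T \<in> \<Gamma> \<longleftrightarrow> bij T \<and> (\<exists>\<sigma>. field_aut \<sigma> \<and> semilinear \<sigma> T)"
  by (simp add: GammaL_def perm_grp_def)

lemma det2_semilin:
  assumes "field_aut \<sigma>"
  shows "det2 (semilin \<sigma> u v z) (semilin \<sigma> u v w) = det2 u v * \<sigma> (det2 z w)"
  by (simp add: det2_def semilin_def field_autD[OF assms] algebra_simps)

lemma semilin_in_Gamma:
  assumes "field_aut \<sigma>" "det2 u v \<noteq> 0"
  shows "semilin \<sigma> u v \<in> \<Gamma>"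
proof -
  note \<sigma> = field_autD[OF assms(1)]
  have "inj (semilin \<sigma> u v)"
  proof (rule injI)
    fix z w assume eq: "semilin \<sigma> u v z = semilin \<sigma> u v w"
    have 1: "det2 (semilin \<sigma> u v x) v = \<sigma> (x $ 1) * det2 u v" for x
      by (simp add: det2_def semilin_def algebra_simps)
    have 2: "det2 u (semilin \<sigma> u v x) = \<sigma> (x $ 2) * det2 u v" for x
      by (simp add: det2_def semilin_def algebra_simps)
    have "\<sigma> (z $ 1) = \<sigma> (w $ 1)" "\<sigma> (z $ 2) = \<sigma> (w $ 2)"
      using 1[of z] 1[of w] 2[of z] 2[of w] eq assms(2) by auto
    then show "z = w" by (simp add: vec2_eq_iff \<sigma>)
  qed
  then have "bij (semilin \<sigma> u v)"
    by (simp add: bij_def finite_UNIV_inj_surj)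
  moreover have "semilinear \<sigma> (semilin \<sigma> u v)"
    by (simp add: semilinear_def semilin_def \<sigma> vec2_eq_iff algebra_simps)
  ultimately show ?thesis using assms(1) by (auto simp: mem_Gamma)
qed

text \<open>If the images \<open>u\<close>, \<open>v\<close> of the basis vectors were dependent, the
  coefficients of a linear relation between them, pulled back along \<open>\<sigma>\<close>, would give a
  nonzero vector in the kernel.\<close>

lemma Gamma_cases:
  assumes "T \<in> \<Gamma>"
  obtains \<sigma> u v where "field_aut \<sigma>" "det2 u v \<noteq> 0" "T = semilin \<sigma> u v" "inj T"
proof -
  from assms obtain \<sigma> where T: "bij T" and \<sigma>0: "field_aut \<sigma>" and "semilinear \<sigma> T"
    by (auto simp: mem_Gamma)
  then have add: "T (x + y) = T x + T y" and scal: "T (c *s x) = \<sigma> c *s T x" for x y c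
    by (auto simp: semilinear_def)
  note \<sigma> = field_autD[OF \<sigma>0]
  define u where "u = T (vector [1, 0])"
  define v where "v = T (vector [0, 1])"
  have T_eq: "T = semilin \<sigma> u v"
  proof
    fix z :: "gf9 ^ 2"
    have "z = z $ 1 *s vector [1, 0] + z $ 2 *s vector [0, 1]"
      by (simp add: vec2_eq_iff)
    then have "T z = T (z $ 1 *s vector [1, 0] + z $ 2 *s vector [0, 1])"
      by simp
    then show "T z = semilin \<sigma> u v z"
      by (simp add: add scal semilin_def u_def v_def)
  qed
  have inj: "inj T" using T by (simp add: bij_def)
  have T0: "T z = 0 \<Longrightarrow> z = 0" for z
    using inj_eq[OF inj, of z 0] by (simp add: T_eq semilin_def \<sigma>)
  have "det2 u v \<noteq> 0"
  proof
    assume d: "det2 u v = 0"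
    have kill: "x = 0 \<and> y = 0" if xy: "x *s u + y *s v = 0" for x y
    proof -
      have "T (vector [inv_into UNIV \<sigma> x, inv_into UNIV \<sigma> y]) = 0"
        using xy \<sigma>(1) by (simp add: T_eq semilin_def bij_is_surj surj_f_inv_f)
      from T0[OF this] have "inv_into UNIV \<sigma> x = 0" "inv_into UNIV \<sigma> y = 0" by (simp_all add: vec2_eq_iff)
      then show ?thesis by (metis \<sigma>(1) \<sigma>(5) bij_inv_eq_iff)
    qed
    have "v $ 2 = 0 \<and> - u $ 2 = 0" "v $ 1 = 0 \<and> - u $ 1 = 0"
      by (rule kill, use d in \<open>simp add: vec2_eq_iff det2_def algebra_simps\<close>)+
    then show False using kill[of 1 0] by (simp add: vec2_eq_iff)
  qed
  with \<sigma>0 T_eq inj show ?thesis using that by blast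
qed

lemma group_perm_grp:
  assumes "id \<in> S" "\<And>f g. f \<in> S \<Longrightarrow> g \<in> S \<Longrightarrow> f \<circ> g \<in> S"
    and "\<And>f. f \<in> S \<Longrightarrow> \<exists>g\<in>S. g \<circ> f = id"
  shows "group (perm_grp S)"
  using assms by (intro groupI) (auto simp: perm_grp_def o_assoc)

lemma GammaI: "bij T \<Longrightarrow> field_aut \<sigma> \<Longrightarrow> semilinear \<sigma> T \<Longrightarrow> T \<in> \<Gamma>"
  unfolding mem_Gamma by blast

lemma field_aut_id: "field_aut (id :: gf9 \<Rightarrow> gf9)"
  by (simp add: field_aut_def)

lemma id_in_Gamma: "id \<in> \<Gamma>"
  using bij_id field_aut_id by (rule GammaI) (simp add: semilinear_def)

lemma comp_in_Gamma:
  assumes "S \<in> \<Gamma>" "T \<in> \<Gamma>"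
  shows "S \<circ> T \<in> \<Gamma>"
proof -
  from assms obtain \<sigma> \<tau> where *: "bij S" "field_aut \<sigma>" "semilinear \<sigma> S" "bij T" "field_aut \<tau>" "semilinear \<tau> T"
    unfolding mem_Gamma by blast
  show ?thesis
  proof (rule GammaI)
    show "bij (S \<circ> T)" using * by (simp add: bij_comp)
    show "field_aut (\<sigma> \<circ> \<tau>)"
      using *(2,5) by (simp add: field_aut_def bij_comp)
    show "semilinear (\<sigma> \<circ> \<tau>) (S \<circ> T)"
      using *(3,6) by (simp add: semilinear_def)
  qed
qed

lemma inv_in_Gamma:
  assumes "T \<in> \<Gamma>"
  shows "inv_into UNIV T \<in> \<Gamma>"
proof -
  from assms obtain \<sigma> where T: "bij T" and \<sigma>: "field_aut \<sigma>" and lin: "semilinear \<sigma> T"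
    unfolding mem_Gamma by blast
  note \<sigma>s = field_autD[OF \<sigma>]
  have T_inv: "T (inv_into UNIV T x) = x" for x using T by (simp add: bij_is_surj surj_f_inv_f)
  have \<sigma>_inv: "\<sigma> (inv_into UNIV \<sigma> x) = x" for x using \<sigma>s(1) by (simp add: bij_is_surj surj_f_inv_f)
  have Tinj: "T x = T y \<Longrightarrow> x = y" for x y using T by (meson bij_is_inj injD)
  show ?thesis
  proof (rule GammaI)
    show "bij (inv_into UNIV T)" using T by (rule bij_imp_bij_inv)
    have "bij (inv_into UNIV \<sigma>)" using \<sigma>s(1) by (rule bij_imp_bij_inv)
    moreover have "inv_into UNIV \<sigma> 1 = 1"
      by (rule iffD1[OF \<sigma>s(7)]) (simp add: \<sigma>_inv \<sigma>s(2))
    moreover have "inv_into UNIV \<sigma> (a + b) = inv_into UNIV \<sigma> a + inv_into UNIV \<sigma> b" for a b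
      by (rule iffD1[OF \<sigma>s(7)]) (simp add: \<sigma>_inv \<sigma>s(3))
    moreover have "inv_into UNIV \<sigma> (a * b) = inv_into UNIV \<sigma> a * inv_into UNIV \<sigma> b" for a b
      by (rule iffD1[OF \<sigma>s(7)]) (simp add: \<sigma>_inv \<sigma>s(4))
    ultimately show "field_aut (inv_into UNIV \<sigma>)" by (simp add: field_aut_def)
    have add: "T (x + y) = T x + T y" and scal: "T (c *s x) = \<sigma> c *s T x" for x y c
      using lin by (auto simp: semilinear_def)
    have "inv_into UNIV T (x + y) = inv_into UNIV T x + inv_into UNIV T y" for x y
      by (rule Tinj) (simp add: T_inv add)
    moreover have "inv_into UNIV T (c *s x) = inv_into UNIV \<sigma> c *s inv_into UNIV T x" for c x
      by (rule Tinj) (simp add: T_inv scal \<sigma>_inv)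
    ultimately show "semilinear (inv_into UNIV \<sigma>) (inv_into UNIV T)"
      by (simp add: semilinear_def)
  qed
qed

lemma group_GammaL: "group (GammaL :: (gf9 ^ 2 \<Rightarrow> gf9 ^ 2) monoid)"
proof -
  have "GammaL = perm_grp \<Gamma>" by (simp add: GammaL_def perm_grp_def)
  moreover have "group (perm_grp \<Gamma>)"
  proof (rule group_perm_grp[OF id_in_Gamma comp_in_Gamma])
    fix T assume "T \<in> \<Gamma>"
    then show "\<exists>S\<in>\<Gamma>. S \<circ> T = id"
      by (intro bexI[OF _ inv_in_Gamma]) (auto simp: mem_Gamma bij_is_inj)
  qed
  ultimately show ?thesis by simp
qed

section \<open>The action on the projective line and von Staudt's theorem\<close>

definition act :: "(gf9 ^ 2 \<Rightarrow> gf9 ^ 2) \<Rightarrow> pt \<Rightarrow> pt" where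
  "act T p = point_of (T (rep p))"

lemma Gamma_nonzero: "T \<in> \<Gamma> \<Longrightarrow> z \<noteq> 0 \<Longrightarrow> T z \<noteq> 0"
proof
  assume T: "T \<in> \<Gamma>" and z: "z \<noteq> 0" and 0: "T z = 0"
  then obtain \<sigma> where \<sigma>: "semilinear \<sigma> T" unfolding mem_Gamma by blast
  have "T (z + z) = T z + T z" using \<sigma> unfolding semilinear_def by blast
  then have "T (z + z) = T z" using 0 by simp
  then have "z + z = z" using T unfolding mem_Gamma bij_def by (blast dest: injD)
  then show False using z by (metis add_cancel_right_right)
qed

lemma rep_act:
  assumes "T \<in> \<Gamma>"
  shows "\<exists>c. c \<noteq> 0 \<and> rep (act T p) = c *s T (rep p)"
  unfolding act_def by (intro rep_point_of Gamma_nonzero[OF assms]) simp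

lemma act_id [simp]: "act id = id"
  by (simp add: act_def fun_eq_iff)

lemma act_comp:
  assumes "S \<in> \<Gamma>" "T \<in> \<Gamma>"
  shows "act (S \<circ> T) = act S \<circ> act T"
proof
  fix p
  obtain c where c: "c \<noteq> 0" "rep (act T p) = c *s T (rep p)" using rep_act[OF assms(2)] by blast
  from assms(1) obtain \<sigma> where \<sigma>: "field_aut \<sigma>" "semilinear \<sigma> S" by (auto simp: mem_Gamma)
  have "S (rep (act T p)) = \<sigma> c *s S (T (rep p))"
    using \<sigma> c by (simp add: semilinear_def)
  then have "act S (act T p) = point_of (\<sigma> c *s S (T (rep p)))" by (simp add: act_def[of S])
  also have "\<dots> = act (S \<circ> T) p"
    using c field_autD(8)[OF \<sigma>(1)] by (simp add: point_of_scale act_def[of "S \<circ> T"])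
  finally show "act (S \<circ> T) p = (act S \<circ> act T) p" by simp
qed

lemma act_inv:
  assumes "T \<in> \<Gamma>"
  shows "act (inv_into UNIV T) \<circ> act T = id" "act T \<circ> act (inv_into UNIV T) = id"
proof -
  have "bij T" using assms by (simp add: mem_Gamma)
  then have "inv_into UNIV T \<circ> T = id" "T \<circ> inv_into UNIV T = id" 
    by (simp_all add: bij_is_inj bij_is_surj surj_iff[symmetric])
  then show "act (inv_into UNIV T) \<circ> act T = id" "act T \<circ> act (inv_into UNIV T) = id"
    using act_comp[OF inv_in_Gamma[OF assms] assms] act_comp[OF assms inv_in_Gamma[OF assms]] by auto
qed

lemma bij_act: "T \<in> \<Gamma> \<Longrightarrow> bij (act T)"
  using act_inv o_bij by blast

lemma act_eq_iff [simp]: "T \<in> \<Gamma> \<Longrightarrow> act T p = act T q \<longleftrightarrow> p = q"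
  using bij_act by (simp add: bij_def inj_eq)

text \<open>For distinct points this says that the cross ratio of \<open>p\<close>, \<open>q\<close>,
  \<open>r\<close>, \<open>s\<close> is \<open>-1\<close>. If \<open>p \<noteq> q\<close> and \<open>r
  \<noteq> s\<close>, the equation forces the four points to be distinct.\<close>

definition harmonic :: "pt \<Rightarrow> pt \<Rightarrow> pt \<Rightarrow> pt \<Rightarrow> bool" where
  "harmonic p q r s \<longleftrightarrow>
     det2 (rep p) (rep r) * det2 (rep q) (rep s) + det2 (rep p) (rep s) * det2 (rep q) (rep r) = 0"

text \<open>Each of the two products of determinants contains every one of the four points once, so rescaling
  the representatives multiplies both by the same factor, and a semilinear map applies \<open>\<sigma>\<close>
  to both, up to a common factor.\<close>

lemma harmonic_act:
  assumes T: "T \<in> \<Gamma>"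
  shows "harmonic (act T p) (act T q) (act T r) (act T s) \<longleftrightarrow> harmonic p q r s"
proof -
  obtain \<sigma> u v where \<sigma>: "field_aut \<sigma>" and uv: "det2 u v \<noteq> 0" and T_eq: "T = semilin \<sigma> u v"
    using Gamma_cases[OF T] by blast
  obtain c where c: "\<And>p. c p \<noteq> 0" "\<And>p. rep (act T p) = c p *s T (rep p)"
    using rep_act[OF T] by metis
  define D where "D p q = det2 (rep p) (rep q)" for p q
  have D: "det2 (rep (act T p)) (rep (act T q)) = c p * c q * (det2 u v * \<sigma> (D p q))" for p q
    by (simp only: c(2) det2_scale) (simp only: T_eq det2_semilin[OF \<sigma>] D_def)
  have "harmonic (act T p) (act T q) (act T r) (act T s) \<longleftrightarrow>
     c p * c q * c r * c s * det2 u v * det2 u v * \<sigma> (D p r * D q s + D p s * D q r) = 0"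
    unfolding harmonic_def D by (simp add: field_autD[OF \<sigma>] algebra_simps)
  also have "\<dots> \<longleftrightarrow> harmonic p q r s"
    using c(1) uv by (simp add: harmonic_def D_def field_autD(8)[OF \<sigma>])
  finally show ?thesis .
qed

lemma three_transitive:
  assumes "p \<noteq> q" "p \<noteq> r" "q \<noteq> r"
  obtains T where "T \<in> \<Gamma>" "act T None = p" "act T (Some 0) = q" "act T (Some 1) = r"
proof -
  \<comment> \<open>Cramer's rule: these coefficients make \<open>\<alpha> *s rep p + \<beta> *s rep q\<close> a multiple of \<open>rep r\<close>\<close>
  define \<alpha> where "\<alpha> = det2 (rep r) (rep q)"
  define \<beta> where "\<beta> = det2 (rep p) (rep r)"
  have nz: "\<alpha> \<noteq> 0" "\<beta> \<noteq> 0" using assms by (auto simp: \<alpha>_def \<beta>_def det2_rep_eq_0)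
  define T where "T = semilin id (\<alpha> *s rep p) (\<beta> *s rep q)"
  have T: "T \<in> \<Gamma>"
    unfolding T_def using field_aut_id by (rule semilin_in_Gamma) (use nz assms in \<open>simp add: det2_scale det2_rep_eq_0\<close>)
  have "T (rep None) = \<alpha> *s rep p" "T (rep (Some 0)) = \<beta> *s rep q" 
    by (simp_all add: T_def semilin_def)
  moreover have "T (rep (Some 1)) = det2 (rep p) (rep q) *s rep r"
    by (simp add: T_def semilin_def vec2_eq_iff \<alpha>_def \<beta>_def det2_def algebra_simps)
  ultimately show ?thesis
    using that[OF T] nz assms by (simp add: act_def point_of_scale det2_rep_eq_0)
qed

text \<open>Fixing the points \<open>0\<close>, \<open>1\<close>, \<open>\<infinity>\<close> makes both
  diagonal entries equal, and fixing every other point \<open>x\<close> forces \<open>\<sigma> x =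
  x\<close>.\<close>

lemma act_eq_id_imp_scalar:
  assumes T: "T \<in> \<Gamma>" and "act T = id"
  shows "T \<in> scalar_maps"
proof -
  obtain \<sigma> u v where \<sigma>: "field_aut \<sigma>" and T_eq: "T = semilin \<sigma> u v"
    using Gamma_cases[OF T] by blast
  note \<sigma>s = field_autD[OF \<sigma>]
  have fix1: "\<exists>c. c \<noteq> 0 \<and> rep p = c *s T (rep p)" for p
    using rep_act[OF T, of p] assms(2) by simp
  have "\<exists>d. d \<noteq> 0 \<and> T (rep p) = d *s rep p" for p
  proof -
    obtain c where "c \<noteq> 0" "rep p = c *s T (rep p)" using fix1 by blast
    then have "(1 / c) *s rep p = T (rep p)" by (metis nonzero_eq_divide_eq vector_smult_assoc vector_smult_lid)
    then show ?thesis using \<open>c \<noteq> 0\<close> by (intro exI[of _ "1 / c"]) simp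
  qed
  then obtain d where d: "\<And>p. d p \<noteq> 0" "\<And>p. T (rep p) = d p *s rep p" by metis
  have u: "u = d None *s rep None" using d(2)[of None] by (simp add: T_eq semilin_def \<sigma>s)
  have v: "v = d (Some 0) *s rep (Some 0)" using d(2)[of "Some 0"] by (simp add: T_eq semilin_def \<sigma>s)
  have ab: "d (Some 0) = d (Some x)" "\<sigma> x * d None = d (Some x) * x" for x
    using d(2)[of "Some x"] by (simp_all add: T_eq semilin_def \<sigma>s u v vec2_eq_iff)
  have eq: "d (Some 0) = d None" using ab[of 1] \<sigma>s(2) by simp
  have \<sigma>x: "\<sigma> x = x" for x using ab[of x] eq d(1)[of None] by simp
  have "T = (\<lambda>x. d None *s x)"
    by (rule ext) (simp add: T_eq semilin_def \<sigma>x u v eq vec2_eq_iff mult.commute)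
  then show ?thesis using d(1) by (auto simp: scalar_maps_def)
qed

lemma scalar_in_Gamma:
  assumes "T \<in> scalar_maps"
  shows "T \<in> \<Gamma>" "act T = id"
proof -
  from assms obtain c where c: "c \<noteq> 0" "T = (\<lambda>x. c *s x)" by (auto simp: scalar_maps_def)
  have "T = semilin id (c *s rep None) (c *s rep (Some 0))"
    by (rule ext) (simp add: c semilin_def vec2_eq_iff)
  moreover have "semilin id (c *s rep None) (c *s rep (Some 0)) \<in> \<Gamma>"
    using field_aut_id by (rule semilin_in_Gamma) (simp add: c det2_scale det2_rep_eq_0)
  ultimately show "T \<in> \<Gamma>" by (simp only:)
  show "act T = id" by (rule ext) (simp add: c act_def point_of_scale)
qed

lemma harmonic_None_Some [simp]:
  "harmonic None (Some a) (Some c) (Some d) \<longleftrightarrow> a + c + d = 0"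
proof -
  have "harmonic None (Some a) (Some c) (Some d) \<longleftrightarrow> (a + a) - c - d = 0"
    by (simp add: harmonic_def det2_def algebra_simps)
  also have "\<dots> \<longleftrightarrow> - (a + c + d) = 0" unfolding gf9_double by (simp add: algebra_simps)
  finally show ?thesis by (simp only: neg_equal_0_iff_equal)
qed

lemma harmonic_Some:
  "harmonic (Some a) (Some b) (Some c) (Some d) \<longleftrightarrow> a * b + c * d + (a + b) * (c + d) = 0"
proof -
  have "harmonic (Some a) (Some b) (Some c) (Some d) \<longleftrightarrow>
    (a * b + a * b) + (c * d + c * d) - (a + b) * (c + d) = 0"
    by (simp add: harmonic_def det2_def algebra_simps)
  also have "\<dots> \<longleftrightarrow> - (a * b + c * d + (a + b) * (c + d)) = 0"
    unfolding gf9_double by (simp add: algebra_simps)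
  finally show ?thesis by (simp only: neg_equal_0_iff_equal)
qed

text \<open>In characteristic 3 the harmonic conjugate of \<open>\<infinity>\<close> with respect to
  \<open>x\<close>, \<open>y\<close> is their midpoint \<open>-(x + y)\<close>, so \<open>\<pi>\<close> is
  additive. The pairs \<open>{x, -x}\<close> and \<open>{1, x\<^sup>2}\<close> are harmonic, so
  \<open>\<pi>\<close> respects squares, and therefore also products, since \<open>2xy = (x + y)\<^sup>2 -
  x\<^sup>2 - y\<^sup>2\<close> and 2 is invertible.\<close>

lemma von_Staudt_fixed:
  assumes bij: "bij \<pi>" and fixed: "\<pi> None = None" "\<pi> (Some 0) = Some 0" "\<pi> (Some 1) = Some 1"
    and harm: "\<And>p q r s. p \<noteq> q \<Longrightarrow> r \<noteq> s \<Longrightarrow> harmonic p q r s \<Longrightarrow> harmonic (\<pi> p) (\<pi> q) (\<pi> r) (\<pi> s)"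
  obtains T where "T \<in> \<Gamma>" "act T = \<pi>"
proof -
  have inj: "\<pi> p = \<pi> q \<longleftrightarrow> p = q" for p q using bij by (simp add: bij_def inj_eq)
  define \<sigma> where "\<sigma> x = the (\<pi> (Some x))" for x
  have \<pi>: "\<pi> (Some x) = Some (\<sigma> x)" for x
    using inj[of "Some x" None] fixed(1) by (auto simp: \<sigma>_def)
  have \<sigma>01: "\<sigma> 0 = 0" "\<sigma> 1 = 1" using fixed \<pi> by auto
  have sum0: "\<sigma> (- (x + y)) = - (\<sigma> x + \<sigma> y)" if "x \<noteq> y" for x y
    using harm[of None "Some (- (x + y))" "Some x" "Some y"] that
    by (simp add: fixed \<pi> algebra_simps eq_neg_iff_add_eq_0)
  have minus: "\<sigma> (- x) = - \<sigma> x" for x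
    using sum0[of x 0] by (cases "x = 0") (simp_all add: \<sigma>01)
  have add: "\<sigma> (x + y) = \<sigma> x + \<sigma> y" for x y
  proof (cases "x = y")
    case True then show ?thesis by (simp only: gf9_double minus)
  next
    case False then show ?thesis using sum0[OF False] minus by (metis minus_minus)
  qed
  have square: "\<sigma> (x * x) = \<sigma> x * \<sigma> x" for x
  proof -
    consider "x = 0" | "x * x = 1" | "x \<noteq> 0" "x * x \<noteq> 1" by blast
    then show ?thesis
    proof cases
      case 2
      then have "x = 1 \<or> x = - 1" by (simp add: square_eq_1_iff)
      then show ?thesis using \<sigma>01 minus[of 1] by auto
    next
      case 3
      have "x \<noteq> - x" using gf9_neq_minus 3 by blast
      then have "harmonic (Some (\<sigma> x)) (Some (- \<sigma> x)) (Some 1) (Some (\<sigma> (x * x)))"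
        using harm[of "Some x" "Some (- x)" "Some 1" "Some (x * x)"] 3
        by (simp add: \<pi> minus \<sigma>01 harmonic_Some)
      then show ?thesis by (simp add: harmonic_Some)
    qed (simp add: \<sigma>01)
  qed
  have mult: "\<sigma> (x * y) = \<sigma> x * \<sigma> y" for x y
  proof -
    have "\<sigma> ((x + y) * (x + y)) = (\<sigma> x + \<sigma> y) * (\<sigma> x + \<sigma> y)"
      unfolding square add ..
    then have "\<sigma> (x * y + x * y) = \<sigma> x * \<sigma> y + \<sigma> x * \<sigma> y"
      by (simp add: distrib_left distrib_right add square mult.commute[of y x] mult.commute[of "\<sigma> y" "\<sigma> x"])
    then show ?thesis by (simp only: gf9_double minus neg_equal_iff_equal)
  qed
  have "inj \<sigma>" using inj \<pi> by (metis injI option.inject)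
  then have \<sigma>: "field_aut \<sigma>"
    by (simp add: field_aut_def bij_def finite_UNIV_inj_surj \<sigma>01 add mult)
  have "semilin \<sigma> (rep None) (rep (Some 0)) \<in> \<Gamma>"
    using \<sigma> by (rule semilin_in_Gamma) (simp add: det2_rep_eq_0)
  moreover have "act (semilin \<sigma> (rep None) (rep (Some 0))) p = \<pi> p" for p
    by (cases p) (simp_all add: act_def semilin_def point_of_def \<sigma>01 \<pi> fixed)
  ultimately show ?thesis using that by blast
qed

lemma von_Staudt:
  assumes bij: "bij \<pi>"
    and harm: "\<And>p q r s. p \<noteq> q \<Longrightarrow> r \<noteq> s \<Longrightarrow> harmonic p q r s \<Longrightarrow> harmonic (\<pi> p) (\<pi> q) (\<pi> r) (\<pi> s)"
  obtains T where "T \<in> \<Gamma>" "act T = \<pi>"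
proof -
  have inj: "\<pi> p = \<pi> q \<longleftrightarrow> p = q" for p q using bij by (simp add: bij_def inj_eq)
  obtain S where S: "S \<in> \<Gamma>" "act S None = \<pi> None" "act S (Some 0) = \<pi> (Some 0)" "act S (Some 1) = \<pi> (Some 1)"
    by (rule three_transitive[of "\<pi> None" "\<pi> (Some 0)" "\<pi> (Some 1)"]) (auto simp: inj)
  note S' = inv_in_Gamma[OF S(1)]
  have TS: "act (inv_into UNIV S) (act S p) = p"
    and ST: "act S (act (inv_into UNIV S) p) = p" for p
    using act_inv[OF S(1)] by (simp_all add: fun_eq_iff)
  obtain T where T: "T \<in> \<Gamma>" "act T = act (inv_into UNIV S) \<circ> \<pi>"
  proof (rule von_Staudt_fixed[of "act (inv_into UNIV S) \<circ> \<pi>"])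
    show "bij (act (inv_into UNIV S) \<circ> \<pi>)" using bij bij_act[OF S'] by (rule bij_comp)
  qed (simp_all add: S(2-4)[symmetric] TS harmonic_act[OF S'] harm)
  have "act (S \<circ> T) = \<pi>" using act_comp[OF S(1) T(1)] T(2) by (auto simp: ST)
  then show ?thesis using that comp_in_Gamma[OF S(1) T(1)] by blast
qed

section \<open>The harmonic graph on pairs of points\<close>

definition Pairs :: "pt set set" where
  "Pairs = {{p, q} | p q. p \<noteq> q}"

definition conjugate :: "pt set \<Rightarrow> pt set \<Rightarrow> bool" where
  "conjugate e f \<longleftrightarrow> (\<exists>p q r s. e = {p, q} \<and> f = {r, s} \<and> p \<noteq> q \<and> r \<noteq> s \<and> harmonic p q r s)"

lemma harmonic_swap: "harmonic q p r s \<longleftrightarrow> harmonic p q r s" "harmonic p q s r \<longleftrightarrow> harmonic p q r s"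
  by (simp_all add: harmonic_def algebra_simps)

lemma harmonic_sym: "harmonic r s p q \<longleftrightarrow> harmonic p q r s"
  by (simp add: harmonic_def det2_def algebra_simps)

lemma conjugate_iff: "p \<noteq> q \<Longrightarrow> r \<noteq> s \<Longrightarrow> conjugate {p, q} {r, s} \<longleftrightarrow> harmonic p q r s"
  unfolding conjugate_def by (auto simp: doubleton_eq_iff harmonic_swap)

lemma conjugate_sym: "conjugate e f \<longleftrightarrow> conjugate f e"
  unfolding conjugate_def using harmonic_sym by blast

lemma conjugate_in_Pairs: "conjugate e f \<Longrightarrow> e \<in> Pairs \<and> f \<in> Pairs"
  by (auto simp: conjugate_def Pairs_def)

lemma Pairs_I: "p \<noteq> q \<Longrightarrow> {p, q} \<in> Pairs"
  by (auto simp: Pairs_def)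

lemma Pairs_E:
  assumes "e \<in> Pairs" obtains p q where "e = {p, q}" "p \<noteq> q"
  using assms by (auto simp: Pairs_def)

lemma Pairs_mem_E:
  assumes "e \<in> Pairs" "p \<in> e" obtains q where "e = {p, q}" "p \<noteq> q"
proof -
  obtain a b where ab: "e = {a, b}" "a \<noteq> b" using assms(1) by (rule Pairs_E)
  show ?thesis
  proof (cases "p = a")
    case True
    then show ?thesis using that ab by blast
  next
    case False
    then have "e = {p, a}" using ab assms(2) by blast
    then show ?thesis using that False by blast
  qed
qed

lemma image_in_Pairs: "T \<in> \<Gamma> \<Longrightarrow> e \<in> Pairs \<Longrightarrow> act T ` e \<in> Pairs"
  by (auto elim!: Pairs_E intro!: Pairs_I)

lemma conjugate_image_imp: "T \<in> \<Gamma> \<Longrightarrow> conjugate e f \<Longrightarrow> conjugate (act T ` e) (act T ` f)"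
proof -
  assume T: "T \<in> \<Gamma>" and "conjugate e f"
  then obtain p q r s where "e = {p, q}" "f = {r, s}" "p \<noteq> q" "r \<noteq> s" "harmonic p q r s"
    unfolding conjugate_def by blast
  then show "conjugate (act T ` e) (act T ` f)" using T by (simp add: conjugate_iff harmonic_act)
qed

lemma image_inv:
  assumes "T \<in> \<Gamma>"
  shows "act (inv_into UNIV T) ` act T ` e = e" "act T ` act (inv_into UNIV T) ` e = e"
  unfolding image_comp act_inv[OF assms] by simp_all

definition walk2 :: "pt set \<Rightarrow> pt set \<Rightarrow> bool" where
  "walk2 e f \<longleftrightarrow> (\<exists>g. conjugate e g \<and> conjugate g f)"

definition walk3 :: "pt set \<Rightarrow> pt set \<Rightarrow> bool" where
  "walk3 e f \<longleftrightarrow> (\<exists>g h. conjugate e g \<and> conjugate g h \<and> conjugate h f)"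

lemma
  assumes "T \<in> \<Gamma>"
  shows conjugate_image: "conjugate (act T ` e) (act T ` f) \<longleftrightarrow> conjugate e f"
    and walk2_image: "walk2 (act T ` e) (act T ` f) \<longleftrightarrow> walk2 e f"
    and walk3_image: "walk3 (act T ` e) (act T ` f) \<longleftrightarrow> walk3 e f"
proof -
  have walk2: "walk2 e f \<Longrightarrow> walk2 (act S ` e) (act S ` f)" if "S \<in> \<Gamma>" for S e f
    unfolding walk2_def using conjugate_image_imp[OF that] by blast
  have walk3: "walk3 e f \<Longrightarrow> walk3 (act S ` e) (act S ` f)" if "S \<in> \<Gamma>" for S e f
    unfolding walk3_def using conjugate_image_imp[OF that] by blast
  note T' = inv_in_Gamma[OF assms]
  show "conjugate (act T ` e) (act T ` f) \<longleftrightarrow> conjugate e f"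
    using conjugate_image_imp[OF assms, of e f] conjugate_image_imp[OF T', of "act T ` e" "act T ` f"]
    unfolding image_inv[OF assms] by blast
  show "walk2 (act T ` e) (act T ` f) \<longleftrightarrow> walk2 e f"
    using walk2[OF assms, of e f] walk2[OF T', of "act T ` e" "act T ` f"]
    unfolding image_inv[OF assms] by blast
  show "walk3 (act T ` e) (act T ` f) \<longleftrightarrow> walk3 e f"
    using walk3[OF assms, of e f] walk3[OF T', of "act T ` e" "act T ` f"]
    unfolding image_inv[OF assms] by blast
qed

abbreviation e0 :: "pt set" where "e0 \<equiv> {None, Some 0}"

lemma e0_in_Pairs: "e0 \<in> Pairs" by (simp add: Pairs_I)

lemma Pairs_transitive:
  assumes "e \<in> Pairs"
  obtains T where "T \<in> \<Gamma>" "act T ` e0 = e"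
proof -
  obtain p q where pq: "e = {p, q}" "p \<noteq> q" using assms by (rule Pairs_E)
  have "\<exists>r. r \<noteq> p \<and> r \<noteq> q"
    using pq(2) by (metis option.distinct(1) option.inject zero_neq_one)
  then obtain r where "r \<noteq> p" "r \<noteq> q" by blast
  then obtain T where "T \<in> \<Gamma>" "act T None = p" "act T (Some 0) = q"
    using three_transitive[of p q r] pq(2) by metis
  then show ?thesis using that pq(1) by simp
qed

lemma conjugate_e0_Some: "conjugate e0 {Some c, Some d} \<longleftrightarrow> c \<noteq> d \<and> c + d = 0"
proof (cases "c = d")
  case True
  then have "{Some c, Some d} \<notin> Pairs" by (auto simp: Pairs_def doubleton_eq_iff)
  then show ?thesis using True conjugate_in_Pairs by blast
qed (simp add: conjugate_iff)

lemma not_harmonic_None: "\<not> harmonic None q None s"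
  if "q \<noteq> None" "s \<noteq> None"
  using that by (cases q; cases s) (simp_all add: harmonic_def det2_def)

lemma conjugate_None_E:
  assumes "conjugate {None, Some b} g"
  obtains c d where "g = {Some c, Some d}" "c \<noteq> d" "b + c + d = 0"
proof -
  obtain r s where g: "g = {r, s}" "r \<noteq> s" using conjugate_in_Pairs[OF assms] by (auto elim: Pairs_E)
  have h: "harmonic None (Some b) r s" using assms g by (simp add: conjugate_iff)
  then have "r \<noteq> None" "s \<noteq> None"
    using g(2) not_harmonic_None[of "Some b" s] not_harmonic_None[of "Some b" r] harmonic_swap
    by (metis option.distinct(1))+
  then obtain c d where "r = Some c" "s = Some d" by blast
  then show ?thesis using that g h by simp
qed

lemma conjugate_e0_E:
  assumes "conjugate e0 g"
  obtains a where "a \<noteq> 0" "g = {Some a, Some (- a)}"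
proof -
  from assms obtain c d where "g = {Some c, Some d}" "c \<noteq> d" "0 + c + d = 0" by (rule conjugate_None_E)
  moreover from this have "d = - c" by (simp add: eq_neg_iff_add_eq_0 add.commute)
  moreover from calculation have "c \<noteq> 0" by auto
  ultimately show ?thesis using that by blast
qed

text \<open>The walk from \<open>{\<infinity>, 0}\<close> to \<open>{\<infinity>, 1}\<close> passes through
  \<open>{i, -i}\<close> and \<open>{1 + i, 1 - i}\<close>.\<close>

lemma walk3_e0_touching: "walk3 e0 {None, Some 1}"
proof -
  have "conjugate e0 {Some (GF9 0 1), Some (GF9 0 2)}"
    unfolding conjugate_e0_Some by (simp add: gf9_defs)
  moreover have "conjugate {Some (GF9 0 1), Some (GF9 0 2)} {Some (GF9 1 1), Some (GF9 1 2)}"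
    by (subst conjugate_iff) (simp_all add: harmonic_Some gf9_defs)
  moreover have "conjugate {None, Some 1} {Some (GF9 1 1), Some (GF9 1 2)}"
    by (subst conjugate_iff) (simp_all add: gf9_defs)
  ultimately show ?thesis unfolding walk3_def using conjugate_sym by blast
qed

text \<open>A walk of length 3 runs through \<open>{a, -a}\<close> and a pair \<open>{x, y}\<close> whose
  product is \<open>a\<^sup>2\<close> and whose sum is determined by \<open>a\<close>, \<open>c\<close>,
  \<open>d\<close>. The discriminant of the quadratic equation for \<open>x\<close> and \<open>y\<close> is,
  up to squares, \<open>(a\<^sup>2 - c\<^sup>2)(a\<^sup>2 - d\<^sup>2)\<close>. Unless \<open>d/c\<close> is
  \<open>-1\<close> or a square root of \<open>-1\<close>, this is never a nonzero square.\<close>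

lemma walk3_e0_disjoint:
  assumes W: "walk3 e0 {Some c, Some d}" and cd: "c \<noteq> 0" "d \<noteq> 0" "c \<noteq> d"
  shows "c + d = 0 \<or> c * c + d * d = 0"
proof (rule ccontr)
  assume "\<not> ?thesis"
  then have s: "c + d \<noteq> 0" "c * c + d * d \<noteq> 0" by auto
  obtain g h where gh: "conjugate e0 g" "conjugate g h" "conjugate h {Some c, Some d}"
    using W unfolding walk3_def by blast
  obtain a where a: "a \<noteq> 0" "g = {Some a, Some (- a)}" using gh(1) by (rule conjugate_e0_E)
  have a': "a \<noteq> - a" using gf9_neq_minus a(1) by blast
  obtain p q where h: "h = {p, q}" "p \<noteq> q" using conjugate_in_Pairs[OF gh(2)] by (auto elim: Pairs_E)
  have "None \<notin> h"
  proof
    assume "None \<in> h"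
    then obtain b where b: "h = {None, Some b}" using h by (cases p; cases q) auto
    have "b = 0" using gh(2) a' conjugate_sym unfolding a b by (simp add: conjugate_sym[of _ "{None, Some b}"] conjugate_iff)
    then have "conjugate e0 {Some c, Some d}" using gh(3) b by simp
    then show False using s by (simp add: conjugate_e0_Some)
  qed
  then obtain x y where xy: "h = {Some x, Some y}" "x \<noteq> y" using h by (cases p; cases q) auto
  have 1: "x * y = a * a"
    using gh(2) a' xy(2) unfolding a xy(1) by (simp add: conjugate_iff harmonic_Some)
  have "x * y + c * d + (x + y) * (c + d) = 0"
    using gh(3) cd xy by (simp add: conjugate_iff harmonic_Some)
  then have 2: "(c + d) * (x + y) = - (c * d + a * a)"
    unfolding 1 by (simp add: algebra_simps eq_neg_iff_add_eq_0)
  \<comment> \<open>the coefficient \<open>4\<close> of the discriminant is \<open>1\<close> in characteristic 3\<close>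
  have sq: "(x - y) * (x - y) = (x + y) * (x + y) - x * y"
  proof -
    have "(x - y) * (x - y) = (x + y) * (x + y) - x * y - (x * y + x * y + x * y)"
      by (simp add: algebra_simps)
    then show ?thesis by (simp add: gf9_double del: mult_2)
  qed
  define z where "z = (c + d) * (x - y)"
  have "z * z = ((c + d) * (x + y)) * ((c + d) * (x + y)) - (c + d) * (c + d) * (a * a)"
  proof -
    have "z * z = (c + d) * (c + d) * ((x - y) * (x - y))" by (simp add: z_def algebra_simps)
    then show ?thesis unfolding sq 1 by (simp add: algebra_simps)
  qed
  also have "\<dots> = (a * a - c * c) * (a * a - d * d)"
    unfolding 2 by (simp add: algebra_simps)
  finally have z: "z * z = (a * a - c * c) * (a * a - d * d)" .
  have "z / (c * c) = 0"
  proof (rule gf9_nonsquare[of "a / c" "d / c"])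
    show "a / c \<noteq> 0" "d / c \<noteq> 0" "d / c \<noteq> 1" using cd a by auto
    show "d / c \<noteq> - 1"
    proof
      assume "d / c = - 1"
      then have "d = - c" using cd by (simp add: divide_eq_eq)
      then show False using s by simp
    qed
    show "d / c * (d / c) \<noteq> - 1"
    proof
      assume "d / c * (d / c) = - 1"
      then have "d * d = - (c * c)" using cd by (simp add: divide_eq_eq)
      then show False using s by simp
    qed
    have "z / (c * c) * (z / (c * c)) = (z * z) / (c * c * (c * c))" by simp
    also have "\<dots> = (a / c * (a / c) - 1) * (a / c * (a / c) - d / c * (d / c))"
      unfolding z using cd by (simp add: field_simps)
    finally show "z / (c * c) * (z / (c * c)) = (a / c * (a / c) - 1) * (a / c * (a / c) - d / c * (d / c))" .
  qed
  then show False using cd s xy(2) by (simp add: z_def)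
qed

text \<open>If \<open>d = tc\<close> with \<open>t\<^sup>2 = -1\<close>, then \<open>cd = tc\<^sup>2\<close>
  is a square \<open>a\<^sup>2\<close>, because \<open>t\<close> is one; the middle of the walk is \<open>{a,
  -a}\<close>.\<close>

lemma walk2_e0:
  assumes "c * c + d * d = 0" "c \<noteq> 0" "c \<noteq> d"
  shows "walk2 e0 {Some c, Some d}"
proof -
  have "d * d = - (c * c)" using assms(1) by (simp add: eq_neg_iff_add_eq_0 add.commute)
  then have "d / c * (d / c) = - 1" using assms(2) by simp
  then obtain t where t: "t * t = d / c" using gf9_root by blast
  define a where "a = c * t"
  have a2: "a * a = c * d" using t assms(2) by (simp add: a_def algebra_simps) 
  have "d \<noteq> 0" using assms by auto
  then have "a \<noteq> 0" using a2 assms(2) by auto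
  then have a: "a \<noteq> - a" using gf9_neq_minus by blast
  have "conjugate e0 {Some a, Some (- a)}" using a by (simp add: conjugate_e0_Some)
  moreover have "conjugate {Some a, Some (- a)} {Some c, Some d}"
    using a assms(3) a2 by (simp add: conjugate_iff harmonic_Some)
  ultimately show ?thesis unfolding walk2_def by blast
qed

lemma disjoint_e0_E:
  assumes "f \<in> Pairs" "e0 \<inter> f = {}"
  obtains c d where "f = {Some c, Some d}" "c \<noteq> 0" "d \<noteq> 0" "c \<noteq> d"
proof -
  obtain p q where pq: "f = {p, q}" "p \<noteq> q" using assms(1) by (rule Pairs_E)
  then obtain c d where "p = Some c" "q = Some d" using assms(2) by (cases p; cases q) auto
  then show thesis using that[of c d] pq assms(2) by auto
qed

text \<open>Having a common point is definable in the harmonic graph. By transitivity one of the pairs may be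
  taken to be \<open>{\<infinity>, 0}\<close>. The pairs \<open>{c, d}\<close> disjoint from it fall into
  three classes according to \<open>d/c\<close>: for \<open>-1\<close> they are adjacent to it, for square
  roots of \<open>-1\<close> they are at distance 2, and for elements of order 8 they are too far
  away.\<close>

lemma meet_iff:
  assumes "e \<in> Pairs" "f \<in> Pairs" "e \<noteq> f"
  shows "e \<inter> f \<noteq> {} \<longleftrightarrow> \<not> conjugate e f \<and> \<not> walk2 e f \<and> walk3 e f"
proof
  assume "e \<inter> f \<noteq> {}"
  then obtain p where "p \<in> e" "p \<in> f" by blast
  obtain q where e: "e = {p, q}" "p \<noteq> q" using assms(1) \<open>p \<in> e\<close> by (rule Pairs_mem_E)
  obtain r where f: "f = {p, r}" "p \<noteq> r" using assms(2) \<open>p \<in> f\<close> by (rule Pairs_mem_E)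
  have "q \<noteq> r" using e f assms(3) by blast
  with e(2) f(2) obtain T
    where T: "T \<in> \<Gamma>" "act T None = p" "act T (Some 0) = q" "act T (Some 1) = r"
    by (rule three_transitive)
  have ef: "e = act T ` e0" "f = act T ` {None, Some 1}" using T e f by auto
  have "\<not> conjugate e0 {None, Some 1}"
    using conjugate_e0_E[of "{None, Some 1}" False] by (auto simp: doubleton_eq_iff)
  moreover have "\<not> walk2 e0 {None, Some 1}"
  proof
    assume "walk2 e0 {None, Some 1}"
    then obtain g where g: "conjugate e0 g" "conjugate {None, Some 1} g" unfolding walk2_def using conjugate_sym by blast
    obtain a where a: "a \<noteq> 0" "g = {Some a, Some (- a)}" using g(1) by (rule conjugate_e0_E)
    then show False using g(2) gf9_neq_minus[OF a(1)] by (simp add: conjugate_iff)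
  qed
  ultimately show "\<not> conjugate e f \<and> \<not> walk2 e f \<and> walk3 e f"
    using walk3_e0_touching unfolding ef conjugate_image[OF T(1)] walk2_image[OF T(1)] walk3_image[OF T(1)] by blast
next
  assume *: "\<not> conjugate e f \<and> \<not> walk2 e f \<and> walk3 e f"
  show "e \<inter> f \<noteq> {}"
  proof
    assume disj: "e \<inter> f = {}"
    obtain T where T: "T \<in> \<Gamma>" "act T ` e0 = e" using Pairs_transitive[OF assms(1)] by blast
    define f' where "f' = act (inv_into UNIV T) ` f"
    have f: "f = act T ` f'" unfolding f'_def image_inv[OF T(1)] ..
    have "f' \<in> Pairs" unfolding f'_def using image_in_Pairs[OF inv_in_Gamma[OF T(1)] assms(2)] .
    moreover have "e0 \<inter> f' = {}" using disj unfolding f T(2)[symmetric] by auto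
    ultimately obtain c d where cd: "f' = {Some c, Some d}" "c \<noteq> 0" "d \<noteq> 0" "c \<noteq> d"
      by (rule disjoint_e0_E)
    have "\<not> conjugate e0 f' \<and> \<not> walk2 e0 f' \<and> walk3 e0 f'"
      using * unfolding f T(2)[symmetric] conjugate_image[OF T(1)] walk2_image[OF T(1)] walk3_image[OF T(1)] .
    then show False
      using walk3_e0_disjoint[of c d] walk2_e0[of c d] cd by (auto simp: conjugate_e0_Some)
  qed
qed

section \<open>Permutations of pairs come from permutations of points\<close>

text \<open>Three sets with two elements that meet pairwise may form a triangle, which has no common point,
  but a fourth set cannot meet all sides of the triangle.\<close>

lemma common_point:
  assumes two: "\<And>e. e \<in> F \<Longrightarrow> \<exists>x y. e = {x, y}"
    and meet: "\<And>e f. e \<in> F \<Longrightarrow> f \<in> F \<Longrightarrow> e \<inter> f \<noteq> {}"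
    and card: "3 < card F"
  obtains c where "\<And>e. e \<in> F \<Longrightarrow> c \<in> e"
proof (rule ccontr)
  assume "\<not> thesis"
  then have no: "\<exists>e\<in>F. c \<notin> e" for c using that by blast
  have "F \<noteq> {}" using card by auto
  then obtain e where e: "e \<in> F" by blast
  obtain x y where xy: "e = {x, y}" using two[OF e] by blast
  obtain f where f: "f \<in> F" "x \<notin> f" using no by blast
  have "y \<in> f" using meet[OF e f(1)] f(2) xy by auto
  obtain g where g: "g \<in> F" "y \<notin> g" using no by blast
  have "x \<in> g" using meet[OF e g(1)] g(2) xy by auto
  obtain z where z: "f = {y, z}" using two[OF f(1)] \<open>y \<in> f\<close> by fastforce
  have "z \<in> g" using meet[OF f(1) g(1)] g(2) z by auto
  then have g_eq: "g = {x, z}" using two[OF g(1)] \<open>x \<in> g\<close> f(2) z by fastforce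
  have "h = e \<or> h = f \<or> h = g" if h: "h \<in> F" for h
    using two[OF h] meet[OF h e] meet[OF h f(1)] meet[OF h g(1)] f(2) g(2)
    unfolding xy z g_eq by fastforce
  then have "F \<subseteq> {e, f, g}" by blast
  then have "card F \<le> card {e, f, g}" by (rule card_mono[rotated]) simp
  also have "\<dots> \<le> 3" by (simp add: card_insert_if)
  finally show False using card by simp
qed

lemma card_pt: "5 \<le> card (UNIV :: pt set)"
proof -
  have "card {None, Some 0, Some 1, Some (GF9 0 1), Some (GF9 0 2)} \<le> card (UNIV :: pt set)"
    by (rule card_mono) simp_all
  then show ?thesis by (simp add: gf9_defs)
qed

definition star :: "pt \<Rightarrow> pt set set" where
  "star p = {e \<in> Pairs. p \<in> e}"

lemma card_star: "3 < card (star p)"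
proof -
  have "star p = (\<lambda>q. {p, q}) ` (UNIV - {p})"
    by (auto simp: star_def Pairs_I elim: Pairs_mem_E)
  moreover have "inj_on (\<lambda>q. {p, q}) (UNIV - {p})"
    by (auto simp: inj_on_def doubleton_eq_iff)
  ultimately have "card (star p) = card (UNIV - {p})" by (simp add: card_image)
  then show ?thesis using card_pt by simp
qed

lemma fresh_point: "finite A \<Longrightarrow> card A < 5 \<Longrightarrow> \<exists>p. p \<notin> A" for A :: "pt set"
  using card_pt by (metis UNIV_eq_I linorder_not_less)

text \<open>Pairs through a common point go to pairs through a common point \<open>\<pi> p\<close>, and then
  the image of \<open>{p, q}\<close> can only be \<open>{\<pi> p, \<pi> q}\<close>. This is the argument of
  Whitney's theorem that automorphisms of line graphs come from automorphisms of the graph, applied to the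
  complete graph on the ten points.\<close>

lemma pairs_whitney:
  assumes bij: "bij_betw \<psi> Pairs Pairs"
    and meet: "\<And>e f. e \<in> Pairs \<Longrightarrow> f \<in> Pairs \<Longrightarrow> \<psi> e \<inter> \<psi> f \<noteq> {} \<longleftrightarrow> e \<inter> f \<noteq> {}"
  shows "\<exists>\<pi>. bij \<pi> \<and> (\<forall>e\<in>Pairs. \<psi> e = \<pi> ` e)"
proof -
  have in_Pairs: "\<psi> e \<in> Pairs" if "e \<in> Pairs" for e using bij that by (auto simp: bij_betw_def)
  have inj: "\<psi> e = \<psi> f \<longleftrightarrow> e = f" if "e \<in> Pairs" "f \<in> Pairs" for e f
    using bij that by (auto simp: bij_betw_def inj_on_def)
  have "\<exists>c. \<forall>e\<in>star p. c \<in> \<psi> e" for p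
  proof -
    have "card (\<psi> ` star p) = card (star p)"
      by (rule card_image) (auto simp: inj_on_def star_def inj)
    then have "3 < card (\<psi> ` star p)" using card_star by simp
    moreover have "\<exists>x y. e = {x, y}" if "e \<in> \<psi> ` star p" for e
    proof -
      have "e \<in> Pairs" using that in_Pairs by (auto simp: star_def)
      then show ?thesis by (auto simp: Pairs_def)
    qed
    moreover have "e \<inter> f \<noteq> {}" if ef: "e \<in> \<psi> ` star p" "f \<in> \<psi> ` star p" for e f
    proof -
      obtain e' f' where *: "e = \<psi> e'" "f = \<psi> f'" "e' \<in> star p" "f' \<in> star p" using ef by blast
      then have "e' \<inter> f' \<noteq> {}" by (auto simp: star_def)
      then show ?thesis using * meet by (simp add: star_def)
    qed
    ultimately obtain c where "\<And>e. e \<in> \<psi> ` star p \<Longrightarrow> c \<in> e"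
      using common_point[of "\<psi> ` star p"] by metis
    then show ?thesis by blast
  qed
  then obtain \<pi> where \<pi>: "\<And>p e. e \<in> Pairs \<Longrightarrow> p \<in> e \<Longrightarrow> \<pi> p \<in> \<psi> e"
    unfolding star_def by (metis (no_types, lifting) mem_Collect_eq)
  have "inj \<pi>"
  proof (rule injI, rule ccontr)
    fix p q assume eq: "\<pi> p = \<pi> q" and ne: "p \<noteq> q"
    have "card {p, q} < 5" by (simp add: card_insert_if)
    then obtain r where r: "r \<notin> {p, q}" using fresh_point[of "{p, q}"] by auto
    have "card {p, q, r} < 5" by (simp add: card_insert_if)
    then obtain s where s: "s \<notin> {p, q, r}" using fresh_point[of "{p, q, r}"] by auto
    have Pairs: "{p, r} \<in> Pairs" "{q, s} \<in> Pairs" using r s by (auto intro!: Pairs_I)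
    have "\<pi> p \<in> \<psi> {p, r}" "\<pi> q \<in> \<psi> {q, s}" using \<pi> Pairs by auto
    then have "\<psi> {p, r} \<inter> \<psi> {q, s} \<noteq> {}" using eq by auto
    then have "{p, r} \<inter> {q, s} \<noteq> {}" using meet Pairs by blast
    then show False using r s ne by auto
  qed
  then have "bij \<pi>" by (simp add: bij_def finite_UNIV_inj_surj)
  moreover have "\<psi> e = \<pi> ` e" if e: "e \<in> Pairs" for e
  proof -
    obtain p q where pq: "e = {p, q}" "p \<noteq> q" using e by (rule Pairs_E)
    have "\<pi> p \<in> \<psi> e" "\<pi> q \<in> \<psi> e" using \<pi> e pq by auto
    moreover have "\<pi> p \<noteq> \<pi> q" using \<open>inj \<pi>\<close> pq by (simp add: inj_eq)
    moreover obtain x y where "\<psi> e = {x, y}" using in_Pairs[OF e] by (rule Pairs_E)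
    ultimately show ?thesis using pq by auto
  qed
  ultimately show ?thesis by blast
qed

lemma automorphism_semilinear:
  assumes bij: "bij_betw \<psi> Pairs Pairs"
    and conj: "\<And>e f. e \<in> Pairs \<Longrightarrow> f \<in> Pairs \<Longrightarrow> conjugate (\<psi> e) (\<psi> f) \<longleftrightarrow> conjugate e f"
  shows "\<exists>T\<in>\<Gamma>. \<forall>e\<in>Pairs. \<psi> e = act T ` e"
proof -
  have in_Pairs: "\<psi> e \<in> Pairs" if "e \<in> Pairs" for e using bij that by (auto simp: bij_betw_def)
  have inj: "\<psi> e = \<psi> f \<longleftrightarrow> e = f" if "e \<in> Pairs" "f \<in> Pairs" for e f
    using bij that by (auto simp: bij_betw_def inj_on_def)
  have surj: "\<exists>e\<in>Pairs. g = \<psi> e" if "g \<in> Pairs" for g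
    using bij that by (auto simp: bij_betw_def)
  have walk2: "walk2 (\<psi> e) (\<psi> f) \<longleftrightarrow> walk2 e f" if "e \<in> Pairs" "f \<in> Pairs" for e f
    unfolding walk2_def using that conj surj by (metis conjugate_in_Pairs)
  have walk3: "walk3 (\<psi> e) (\<psi> f) \<longleftrightarrow> walk3 e f" if "e \<in> Pairs" "f \<in> Pairs" for e f
  proof
    assume "walk3 (\<psi> e) (\<psi> f)"
    then obtain g h where gh: "conjugate (\<psi> e) g" "conjugate g h" "conjugate h (\<psi> f)" unfolding walk3_def by blast
    then obtain g' h' where "g' \<in> Pairs" "h' \<in> Pairs" "g = \<psi> g'" "h = \<psi> h'" using surj conjugate_in_Pairs by meson
    then show "walk3 e f" using gh conj that unfolding walk3_def by blast
  next
    assume "walk3 e f"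
    then obtain g h where gh: "conjugate e g" "conjugate g h" "conjugate h f" unfolding walk3_def by blast
    then have "conjugate (\<psi> e) (\<psi> g)" "conjugate (\<psi> g) (\<psi> h)" "conjugate (\<psi> h) (\<psi> f)"
      using conj conjugate_in_Pairs by blast+
    then show "walk3 (\<psi> e) (\<psi> f)" unfolding walk3_def by blast
  qed
  have "\<psi> e \<inter> \<psi> f \<noteq> {} \<longleftrightarrow> e \<inter> f \<noteq> {}" if ef: "e \<in> Pairs" "f \<in> Pairs" for e f
  proof (cases "e = f")
    case True
    have "e \<noteq> {}" "\<psi> e \<noteq> {}" using ef(1) in_Pairs[OF ef(1)] by (auto elim: Pairs_E)
    then show ?thesis using True by simp
  next
    case False
    then show ?thesis
      using meet_iff[OF ef False] meet_iff[OF in_Pairs[OF ef(1)] in_Pairs[OF ef(2)]] inj[OF ef]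
        conj[OF ef] walk2[OF ef] walk3[OF ef] by blast
  qed
  from pairs_whitney[OF bij this] obtain \<pi>
    where \<pi>: "bij \<pi>" "\<And>e. e \<in> Pairs \<Longrightarrow> \<psi> e = \<pi> ` e" by blast
  have \<pi>_inj: "\<pi> p = \<pi> q \<longleftrightarrow> p = q" for p q using \<pi>(1) by (simp add: bij_def inj_eq)
  have "harmonic (\<pi> p) (\<pi> q) (\<pi> r) (\<pi> s)" if "p \<noteq> q" "r \<noteq> s" "harmonic p q r s" for p q r s
  proof -
    have "conjugate (\<psi> {p, q}) (\<psi> {r, s})" using that conj by (simp add: Pairs_I conjugate_iff)
    then show ?thesis using that \<pi>(2) by (simp add: Pairs_I conjugate_iff \<pi>_inj)
  qed
  with \<pi>(1) obtain T where "T \<in> \<Gamma>" "act T = \<pi>" by (rule von_Staudt)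
  then show ?thesis using \<pi>(2) by blast
qed

section \<open>Invariant equivalence relations\<close>

lemma scaling:
  assumes "t \<noteq> 0"
  shows "\<exists>T\<in>\<Gamma>. act T None = None \<and> (\<forall>x. act T (Some x) = Some (t * x))"
proof -
  have T: "semilin id (t *s rep None) (rep (Some 0)) \<in> \<Gamma>"
    using field_aut_id by (rule semilin_in_Gamma) (use assms in \<open>simp add: det2_def\<close>)
  show ?thesis
    by (rule bexI[OF _ T]) (simp add: act_def semilin_def point_of_def mult.commute)
qed

text \<open>Once two pairs with exactly one common point are related, 3-transitivity relates any two pairs
  with a common point, and chains of such pairs connect everything. If \<open>{\<infinity>, 0}\<close> is
  related to \<open>{c, d}\<close> with \<open>d \<noteq> -c\<close>, it is also related to the image
  \<open>{c\<^sup>2/d, c}\<close> under the multiplication by \<open>c/d\<close>, and these two share only the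
  point \<open>c\<close>. If \<open>d = -c\<close>, all harmonic pairs are related, and a walk from
  \<open>{\<infinity>, 0}\<close> to \<open>{\<infinity>, 1}\<close> finishes the proof.\<close>

lemma invariant_equivalence:
  assumes R: "equiv Pairs R"
    and inv: "\<And>T e f. T \<in> \<Gamma> \<Longrightarrow> (e, f) \<in> R \<Longrightarrow> (act T ` e, act T ` f) \<in> R"
  shows "R = Id_on Pairs \<or> R = Pairs \<times> Pairs"
proof (rule disjCI)
  assume nt: "R \<noteq> Pairs \<times> Pairs"
  have sub: "R \<subseteq> Pairs \<times> Pairs" using R by (simp add: equiv_def refl_on_def)
  have refl: "(e, e) \<in> R" if "e \<in> Pairs" for e using R that by (simp add: equiv_def refl_on_def)
  have sym: "(f, e) \<in> R" if "(e, f) \<in> R" for e f using R that by (meson equivE symE)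
  have trans: "(e, g) \<in> R" if "(e, f) \<in> R" "(f, g) \<in> R" for e f g using R that by (meson equivE transE)
  have no_meet: False if pqr: "({p, q}, {p, r}) \<in> R" "p \<noteq> q" "p \<noteq> r" "q \<noteq> r" for p q r
  proof -
    obtain S where S: "S \<in> \<Gamma>" "act S None = p" "act S (Some 0) = q" "act S (Some 1) = r"
      using pqr(2-4) by (rule three_transitive)
    have "(e0, {None, Some 1}) \<in> R"
    proof -
      have "act (inv_into UNIV S) ` {p, q} = e0" "act (inv_into UNIV S) ` {p, r} = {None, Some 1}"
        using image_inv(1)[OF S(1), of e0] image_inv(1)[OF S(1), of "{None, Some 1}"] S(2-4) by simp_all
      then show ?thesis using inv[OF inv_in_Gamma[OF S(1)] pqr(1)] by simp
    qed
    then have share: "({x, y}, {x, z}) \<in> R" if xyz: "x \<noteq> y" "x \<noteq> z" for x y z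
    proof (cases "y = z")
      case True
      then show ?thesis using refl Pairs_I xyz by simp
    next
      case False
      obtain T where T: "T \<in> \<Gamma>" "act T None = x" "act T (Some 0) = y" "act T (Some 1) = z"
        using xyz False by (rule three_transitive)
      then show ?thesis using inv[OF T(1) \<open>(e0, {None, Some 1}) \<in> R\<close>] by simp
    qed
    have "(e, f) \<in> R" if ef: "e \<in> Pairs" "f \<in> Pairs" for e f
    proof -
      obtain a b where ab: "e = {a, b}" "a \<noteq> b" using ef(1) by (rule Pairs_E)
      obtain c d where cd: "f = {c, d}" "c \<noteq> d" using ef(2) by (rule Pairs_E)
      show ?thesis
      proof (cases "a = d")
        case True
        then show ?thesis using share[of a b c] ab cd by (simp add: insert_commute)
      next
        case False
        have "({a, b}, {d, a}) \<in> R" using share[of a b d] ab False by (simp add: insert_commute)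
        moreover have "({d, a}, {d, c}) \<in> R" using share[of d a c] cd False by simp
        ultimately show ?thesis using trans ab cd by (simp add: insert_commute)
      qed
    qed
    then show False using nt sub by auto
  qed
  have no_base: False if f: "(e0, f) \<in> R" "f \<noteq> e0" for f
  proof (cases "e0 \<inter> f = {}")
    case False
    have "f \<in> Pairs" using f sub by auto
    obtain p where p: "p \<in> e0" "p \<in> f" using False by blast
    obtain q where q: "e0 = {p, q}" "p \<noteq> q" using e0_in_Pairs p(1) by (rule Pairs_mem_E)
    obtain r where r: "f = {p, r}" "p \<noteq> r" using \<open>f \<in> Pairs\<close> p(2) by (rule Pairs_mem_E)
    have "q \<noteq> r" using f(2) q r by auto
    then show False using no_meet[of p q r] f(1) q r by simp
  next
    case True
    have "f \<in> Pairs" using f sub by auto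
    then obtain c d where cd: "f = {Some c, Some d}" "c \<noteq> 0" "d \<noteq> 0" "c \<noteq> d"
      using True by (rule disjoint_e0_E)
    have move: "(e0, {Some (t * c), Some (t * d)}) \<in> R" if "t \<noteq> 0" for t
    proof -
      obtain T where "T \<in> \<Gamma>" "act T None = None" "\<And>x. act T (Some x) = Some (t * x)"
        using scaling[OF \<open>t \<noteq> 0\<close>] by blast
      then show ?thesis using inv[of T e0 f] f(1) cd(1) by simp
    qed
    show False
    proof (cases "c + d = 0")
      case False
      have "(e0, {Some (c / d * c), Some (c / d * d)}) \<in> R" using cd by (intro move) simp
      then have "(e0, {Some (c / d * c), Some c}) \<in> R" using cd by simp
      then have "({Some c, Some d}, {Some c, Some (c / d * c)}) \<in> R"
        using trans[OF sym[OF f(1)]] unfolding cd(1) by (simp add: insert_commute)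
      moreover have "c \<noteq> c / d * c" using cd by (auto simp: field_simps)
      moreover have "d \<noteq> c / d * c"
      proof
        assume "d = c / d * c"
        then have "d * d = c * c" using cd(3) by (simp add: eq_divide_eq)
        then have "d = c \<or> d = - c" using square_eq_iff by blast
        then show False using cd False by auto
      qed
      ultimately show False using no_meet cd(4) by blast
    next
      case True
      have d: "d = - c" using True by (simp add: eq_neg_iff_add_eq_0 add.commute)
      have base: "(e0, g) \<in> R" if g: "conjugate e0 g" for g
      proof -
        obtain a where a: "a \<noteq> 0" "g = {Some a, Some (- a)}" using g by (rule conjugate_e0_E)
        then show ?thesis using move[of "a / c"] cd(2) d by simp
      qed
      have hc: "(g, h) \<in> R" if gh: "conjugate g h" for g h
      proof -
        obtain T where T: "T \<in> \<Gamma>" "act T ` e0 = g" using Pairs_transitive conjugate_in_Pairs[OF gh] by blast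
        define h' where "h' = act (inv_into UNIV T) ` h"
        have h: "act T ` h' = h" unfolding h'_def image_inv[OF T(1)] ..
        have "conjugate (act T ` e0) (act T ` h')" using gh unfolding h T(2) .
        then have "(e0, h') \<in> R" unfolding conjugate_image[OF T(1)] by (rule base)
        from inv[OF T(1) this] show ?thesis unfolding h T(2) .
      qed
      have "(e0, {None, Some 1}) \<in> R"
        using walk3_e0_touching hc trans unfolding walk3_def by blast
      then show False using no_meet[of None "Some 0" "Some 1"] by simp
    qed
  qed
  have no_base': "f = e0" if "(e0, f) \<in> R" for f by (rule ccontr) (rule no_base[OF that])
  have eq: "e = f" if ef: "(e, f) \<in> R" for e f
  proof -
    have "e \<in> Pairs" using ef sub by auto
    then obtain T where T: "T \<in> \<Gamma>" "act T ` e0 = e" by (rule Pairs_transitive)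
    have e: "act (inv_into UNIV T) ` e = e0"
      using image_inv(1)[OF T(1), of e0] unfolding T(2) .
    have "(e0, act (inv_into UNIV T) ` f) \<in> R"
      using inv[OF inv_in_Gamma[OF T(1)] ef] unfolding e .
    then have f: "act (inv_into UNIV T) ` f = e0" by (rule no_base')
    have "act T ` e0 = f" using image_inv(2)[OF T(1), of f] unfolding f .
    then show ?thesis unfolding T(2) .
  qed
  show "R = Id_on Pairs"
  proof (rule subset_antisym)
    show "R \<subseteq> Id_on Pairs"
    proof (rule subrelI)
      fix e f assume ef: "(e, f) \<in> R"
      have "e \<in> Pairs" using ef sub by blast
      then show "(e, f) \<in> Id_on Pairs" unfolding eq[OF ef, symmetric] by (rule Id_onI)
    qed
    show "Id_on Pairs \<subseteq> R" by (rule subsetI, erule Id_onE) (simp add: refl)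
  qed
qed

section \<open>Finite verifications\<close>

text \<open>For the finite verifications, elements of the field with nine elements are represented by Gaussian
  integers modulo 3 and vectors of \<open>GF(2)^4\<close> by Boolean quadruples. The code of a point of the
  projective line consists of homogeneous coordinates and of the vector \<open>a\<^sub>p\<close> attached to
  it, which ranges over the ten zeros of \<open>x\<^sub>1x\<^sub>2 + x\<^sub>3x\<^sub>4\<close>. Of the
  bijections between the ten points and the ten zeros, 1440 turn harmonic pairs into flags that share a point
  or a line: any one of them composed with the elements of \<open>P\<Gamma>L(2,9)\<close>. The one listed is
  the first in lexicographic order.\<close>

type_synonym gint = "int \<times> int"
type_synonym word4 = "bool \<times> bool \<times> bool \<times> bool"
type_synonym code = "gint \<times> gint \<times> word4"

definition point_codes :: "code list" where
  "point_codes = [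
   ((1,0), (0,0), False, False, False, False),
   ((0,0), (1,0), False, False, False, True),
   ((0,1), (1,0), False, False, True, False),
   ((0,2), (1,0), True, True, True, True),
   ((1,0), (1,0), False, True, True, False),
   ((1,1), (1,0), False, True, False, True),
   ((1,2), (1,0), True, False, False, False),
   ((2,0), (1,0), True, False, True, False),
   ((2,1), (1,0), True, False, False, True),
   ((2,2), (1,0), False, True, False, False)]"

fun pairs :: "'a list \<Rightarrow> ('a \<times> 'a) list" where
  "pairs [] = []"
| "pairs (x # xs) = map (Pair x) xs @ pairs xs"

definition pair_codes :: "(code \<times> code) list" where
  "pair_codes = pairs point_codes"

fun gadd :: "gint \<Rightarrow> gint \<Rightarrow> gint" where
  "gadd (a,b) (c,d) = (a + c, b + d)"
fun gmul :: "gint \<Rightarrow> gint \<Rightarrow> gint" where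
  "gmul (a,b) (c,d) = (a * c - b * d, a * d + b * c)"
fun gzero :: "gint \<Rightarrow> bool" where
  "gzero (a,b) \<longleftrightarrow> a mod 3 = 0 \<and> b mod 3 = 0"
fun wadd :: "word4 \<Rightarrow> word4 \<Rightarrow> word4" where
  "wadd (a,b,c,d) (a',b',c',d') = (a \<noteq> a', b \<noteq> b', c \<noteq> c', d \<noteq> d')"
fun wsymp :: "word4 \<Rightarrow> word4 \<Rightarrow> bool" where
  "wsymp (a,b,c,d) (a',b',c',d') = (((a \<and> b') \<noteq> (b \<and> a')) \<noteq> ((c \<and> d') \<noteq> (d \<and> c')))"
fun wquad :: "word4 \<Rightarrow> bool" where
  "wquad (a,b,c,d) = ((a \<and> b) \<noteq> (c \<and> d))"

definition words :: "word4 list" where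
  "words = (let B = [False, True] in List.product B (List.product B (List.product B B)))"

definition zero_word :: word4 where "zero_word = (False,False,False,False)"

text \<open>The binary quadratic form that vanishes at the two points of a pair, up to the sign of the middle
  coefficient. Two pairs are harmonic exactly if their forms are orthogonal for the polarization of the
  discriminant, which in characteristic 3 is the bilinear form in \<open>polar_zero\<close> up to
  sign.\<close>

fun pair_form :: "code \<times> code \<Rightarrow> gint \<times> gint \<times> gint" where
  "pair_form ((x,y,_), (x',y',_)) = (gmul y y', gadd (gmul x y') (gmul x' y), gmul x x')"
text \<open>The line is listed in the fixed order of \<open>words\<close>, so that equal lines have equal
  lists.\<close>

fun flag_code :: "code \<times> code \<Rightarrow> word4 \<times> word4 list" where
  "flag_code ((_,_,a), (_,_,b)) = (let v = wadd a b in 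
    (v, filter (\<lambda>w. w = zero_word \<or> w = v \<or> \<not> wsymp v w \<and> wquad w \<noteq> wsymp a w) words))"

fun polar_zero :: "gint \<times> gint \<times> gint \<Rightarrow> gint \<times> gint \<times> gint \<Rightarrow> bool" where
  "polar_zero (a,b,c) (a',b',c') = gzero (gadd (gadd (gmul a c') (gmul c a')) (gmul b b'))"
text \<open>The two equations hold together only for equal flags, so that the exclusive disjunction expresses
  adjacency in the line graph.\<close>

fun flag_touch :: "word4 \<times> word4 list \<Rightarrow> word4 \<times> word4 list \<Rightarrow> bool" where
  "flag_touch (v,l) (w,m) \<longleftrightarrow> (v = w) \<noteq> (l = m)"

definition line_words :: "word4 \<Rightarrow> word4 \<Rightarrow> word4 list" where
  "line_words v u = filter (\<lambda>w. w = zero_word \<or> w = v \<or> w = u \<or> w = wadd v u) words"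

text \<open>The pair \<open>{\<infinity>, 0}\<close> and the two pairs of triangle partners \<open>{1,
  -1}\<close>, \<open>{i, -i}\<close> and \<open>{1 + i, -1 - i}\<close>, \<open>{1 - i, -1 +
  i}\<close>.\<close>

definition butterfly :: "(code \<times> code) list" where
  "butterfly = map (nth pair_codes) [0, 32, 17, 38, 40]"

text \<open>The class of each of the 45 pairs, in the order of \<open>pair_codes\<close>; class
  \<open>k\<close> is sent to the \<open>k\<close>th pair of \<open>butterfly\<close>. Class 0 is a perfect
  matching of the Tutte-Coxeter graph. The classes 1 and 2 alternate along a 10-cycle, and the classes 3 and 4
  along a 20-cycle.\<close>

definition colouring :: "nat list" where
  "colouring = [0, 0, 3, 1, 4, 0, 4, 2, 3, 4, 2, 3, 4, 1, 0, 3, 0, 1, 0, 0, 3, 4, 3, 2, 0, 0, 4, 3, 0, 4, 3, 0, 2, 4, 4, 2, 0, 1, 3, 3, 4, 0, 0, 1, 0]"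

definition fold_table :: "((code \<times> code) \<times> (code \<times> code)) list" where
  "fold_table = zip pair_codes (map (nth butterfly) colouring)"

lemma check_adj: "list_all (\<lambda>(e, x). list_all (\<lambda>(f, y). polar_zero e f = flag_touch x y) (map (\<lambda>l. (pair_form l, flag_code l)) pair_codes))
   (map (\<lambda>l. (pair_form l, flag_code l)) pair_codes)"
  by code_simp

lemma check_valid: "list_all (\<lambda>(v, l). v \<noteq> zero_word \<and>
    list_ex (\<lambda>u. u \<noteq> zero_word \<and> u \<noteq> v \<and> \<not> wsymp v u \<and> l = line_words v u) words) (map flag_code pair_codes)"
  by code_simp

lemma check_surj: "list_all (\<lambda>v. list_all (\<lambda>u. v \<noteq> zero_word \<longrightarrow> u \<noteq> zero_word \<longrightarrow> u \<noteq> v \<longrightarrow> \<not> wsymp v u \<longrightarrow>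
     List.member (map flag_code pair_codes) (v, line_words v u)) words) words"
  by code_simp

lemma check_distinct: "distinct (map flag_code pair_codes)" "distinct point_codes" "distinct butterfly"
  by code_simp+

lemma check_endo: "list_all (\<lambda>(e, x). list_all (\<lambda>(f, y). polar_zero e f \<longrightarrow> polar_zero x y) (map (\<lambda>(l, m). (pair_form l, pair_form m)) fold_table))
   (map (\<lambda>(l, m). (pair_form l, pair_form m)) fold_table)"
  by code_simp

lemma check_count: "map (\<lambda>b. length (filter (\<lambda>(l, m). m = b) fold_table)) butterfly = [15, 5, 5, 10, 10]"
  by code_simp

lemma check_fold_table: "map fst fold_table = pair_codes" "set (map snd fold_table) = set butterfly" "length pair_codes = 45"
   "list_all (List.member pair_codes) butterfly"
  by code_simp+

section \<open>Decoding points\<close>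

definition gf9_of :: "gint \<Rightarrow> gf9" where
  "gf9_of z = GF9 (of_int (fst z)) (of_int (snd z))"

lemma gf9_of_gadd: "gf9_of (gadd x y) = gf9_of x + gf9_of y"
  by (cases x; cases y) (simp add: gf9_of_def gf9_defs)

lemma gf9_of_gmul: "gf9_of (gmul x y) = gf9_of x * gf9_of y"
  by (cases x; cases y) (simp add: gf9_of_def gf9_defs)

lemma of_int_3_eq_0: "(of_int k :: 3) = 0 \<longleftrightarrow> k mod 3 = 0"
  by (simp add: of_int_eq_0_iff_char_dvd dvd_eq_mod_eq_0)

lemma gzero_iff: "gzero x \<longleftrightarrow> gf9_of x = 0"
  by (cases x) (simp add: gf9_of_def zero_gf9_def of_int_3_eq_0)

definition code_point :: "code \<Rightarrow> pt" where
  "code_point c = (if gzero (fst (snd c)) then None else Some (gf9_of (fst c)))"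

lemma check_normalized: "list_all (\<lambda>(x, y, _). if gzero y then x = (1,0) \<and> y = (0,0) else y = (1,0)) point_codes"
  by code_simp

lemma rep_code_point: "rep (code_point c) $ 1 = gf9_of (fst c) \<and> rep (code_point c) $ 2 = gf9_of (fst (snd c))" if "c \<in> set point_codes"
proof -
  obtain x y w where c: "c = (x, y, w)" by (cases c)
  have "if gzero y then x = (1,0) \<and> y = (0,0) else y = (1,0)"
    using check_normalized that unfolding list_all_iff c by blast
  moreover have "gf9_of (1,0) = 1" "gf9_of (0,0) = 0" by (simp_all add: gf9_of_def gf9_defs)
  ultimately show ?thesis by (auto simp: code_point_def c split: if_splits)
qed

lemma gf9_of_eq_iff: "gf9_of x = gf9_of y \<longleftrightarrow> gzero (gadd x (gmul (-1,0) y))"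
proof -
  have "gf9_of (-1,0) = - 1" by (simp add: gf9_of_def gf9_defs)
  then show ?thesis by (simp add: gzero_iff gf9_of_gadd gf9_of_gmul)
qed

lemma check_inj: "list_all (\<lambda>c. list_all (\<lambda>d. gzero (gadd (fst c) (gmul (-1,0) (fst d))) \<longrightarrow>
    gzero (gadd (fst (snd c)) (gmul (-1,0) (fst (snd d)))) \<longrightarrow> c = d) point_codes) point_codes"
  by code_simp

lemma check_points: "list_ex (\<lambda>c. fst c = (1,0) \<and> fst (snd c) = (0,0)) point_codes"
   "list_all (\<lambda>a. list_all (\<lambda>b. list_ex (\<lambda>c. fst c = (a,b) \<and> fst (snd c) = (1,0)) point_codes) [0,1,2]) [0,1,2]"
  by code_simp+

lemma code_point_bij: "bij_betw code_point (set point_codes) UNIV"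
proof (rule bij_betwI')
  fix c d assume cd: "c \<in> set point_codes" "d \<in> set point_codes"
  have "gf9_of (fst c) = gf9_of (fst d) \<longrightarrow> gf9_of (fst (snd c)) = gf9_of (fst (snd d)) \<longrightarrow> c = d"
    using check_inj cd unfolding list_all_iff gf9_of_eq_iff by blast
  then show "code_point c = code_point d \<longleftrightarrow> c = d" using rep_code_point[OF cd(1)] rep_code_point[OF cd(2)] by metis
next
  fix p :: pt
  have gi01: "gf9_of (1,0) = 1" "gf9_of (0,0) = 0" by (simp_all add: gf9_of_def gf9_defs)
  have "\<exists>c\<in>set point_codes. rep p $ 1 = gf9_of (fst c) \<and> rep p $ 2 = gf9_of (fst (snd c))"
  proof (cases p)
    case None
    obtain c where "c \<in> set point_codes" "fst c = (1,0)" "fst (snd c) = (0,0)"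
      using check_points(1) unfolding list_ex_iff by blast
    then show ?thesis using None gi01 by (intro bexI[of _ c]) simp_all
  next
    case (Some x)
    obtain a b where ab: "a \<in> {0,1,2}" "b \<in> {0,1,2}" "x = gf9_of (a, b)"
    proof -
      obtain a' b' where "a' \<in> {0,1,2}" "b' \<in> {0,1,2}" "x = GF9 a' b'" using gf9_exhaust by blast
      moreover have "\<exists>k\<in>{0,1,2}. r = of_int k" if "r \<in> {0,1,2}" for r :: 3
        using that by auto
      ultimately show thesis using that unfolding gf9_of_def by (metis fst_conv snd_conv)
    qed
    then obtain c where "c \<in> set point_codes" "fst c = (a,b)" "fst (snd c) = (1,0)"
      using check_points(2) unfolding list_all_iff list_ex_iff by fastforce
    then show ?thesis using Some gi01 ab(3) by (intro bexI[of _ c]) simp_all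
  qed
  then obtain c where c: "c \<in> set point_codes" "rep p $ 1 = rep (code_point c) $ 1" "rep p $ 2 = rep (code_point c) $ 2"
    using rep_code_point by metis
  then have "rep p = rep (code_point c)" by (simp add: vec2_eq_iff)
  then have "p = code_point c" by (metis point_of_rep)
  then show "\<exists>c\<in>set point_codes. p = code_point c" using c by blast
qed simp

lemma pairs_bij: "distinct xs \<Longrightarrow> bij_betw (\<lambda>(x, y). {x, y}) (set (pairs xs)) {{x, y} | x y. x \<in> set xs \<and> y \<in> set xs \<and> x \<noteq> y}"
proof (induction xs)
  case Nil
  then show ?case by (simp add: bij_betw_def)
next
  case (Cons x xs)
  let ?g = "\<lambda>(x, y). {x, y}"
  have "bij_betw ?g (Pair x ` set xs \<union> set (pairs xs))
      ((\<lambda>y. {x, y}) ` set xs \<union> {{a, b} | a b. a \<in> set xs \<and> b \<in> set xs \<and> a \<noteq> b})"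
  proof (rule bij_betw_combine)
    show "bij_betw ?g (Pair x ` set xs) ((\<lambda>y. {x, y}) ` set xs)"
      by (auto simp: bij_betw_def inj_on_def doubleton_eq_iff image_image)
    show "bij_betw ?g (set (pairs xs)) {{a, b} | a b. a \<in> set xs \<and> b \<in> set xs \<and> a \<noteq> b}"
      using Cons by simp
    show "(\<lambda>y. {x, y}) ` set xs \<inter> {{a, b} | a b. a \<in> set xs \<and> b \<in> set xs \<and> a \<noteq> b} = {}"
      using Cons(2) by (auto simp: doubleton_eq_iff)
  qed
  moreover have "(\<lambda>y. {x, y}) ` set xs \<union> {{a, b} | a b. a \<in> set xs \<and> b \<in> set xs \<and> a \<noteq> b}
     = {{a, b} | a b. a \<in> set (x # xs) \<and> b \<in> set (x # xs) \<and> a \<noteq> b}" (is "?L = ?R")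
  proof
    show "?L \<subseteq> ?R" using Cons(2) by auto
    show "?R \<subseteq> ?L" by (auto simp: insert_commute)
  qed
  ultimately show ?case by simp
qed

definition pair_of :: "code \<times> code \<Rightarrow> pt set" where
  "pair_of l = {code_point (fst l), code_point (snd l)}"

lemma pairs_subset: "set (pairs xs) \<subseteq> set xs \<times> set xs"
  by (induction xs) auto

lemma pair_codes_cases:
  assumes "l \<in> set pair_codes"
  obtains c d where "l = (c, d)" "c \<in> set point_codes" "d \<in> set point_codes" "code_point c \<noteq> code_point d"
proof -
  obtain c d where l: "l = (c, d)" by (cases l)
  then have cd: "c \<in> set point_codes" "d \<in> set point_codes"
    using assms pairs_subset unfolding pair_codes_def by blast+
  have "{c, d} \<in> {{x, y} | x y. x \<in> set point_codes \<and> y \<in> set point_codes \<and> x \<noteq> y}"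
    using bij_betwE[OF pairs_bij[OF check_distinct(2)]] assms l unfolding pair_codes_def by fastforce
  then have "c \<noteq> d" by (auto simp: doubleton_eq_iff)
  then have "code_point c \<noteq> code_point d"
    using inj_on_eq_iff[OF bij_betw_imp_inj_on[OF code_point_bij]] cd by blast
  then show ?thesis using that l cd by blast
qed

lemma pair_of_bij: "bij_betw pair_of (set pair_codes) Pairs"
proof -
  let ?P = "{{x, y} | x y. x \<in> set point_codes \<and> y \<in> set point_codes \<and> x \<noteq> y}"
  have inj: "inj_on code_point (set point_codes)" and surj: "code_point ` set point_codes = UNIV"
    using code_point_bij by (auto simp: bij_betw_def)
  have "bij_betw (image code_point) ?P Pairs"
    unfolding bij_betw_def
  proof
    show "inj_on (image code_point) ?P"
      by (rule inj_on_subset[OF inj_on_image_Pow[OF inj]]) auto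
    show "(image code_point) ` ?P = Pairs"
    proof
      show "(image code_point) ` ?P \<subseteq> Pairs"
      proof (rule image_subsetI)
        fix e assume "e \<in> ?P"
        then obtain c d where "e = {c, d}" "c \<in> set point_codes" "d \<in> set point_codes" "c \<noteq> d" by blast
        then show "code_point ` e \<in> Pairs" using inj_on_eq_iff[OF inj] by (simp add: Pairs_I)
      qed
      show "Pairs \<subseteq> (image code_point) ` ?P"
      proof
        fix e assume "e \<in> Pairs"
        then obtain p q where pq: "e = {p, q}" "p \<noteq> q" by (rule Pairs_E)
        obtain c d where cd: "c \<in> set point_codes" "p = code_point c" "d \<in> set point_codes" "q = code_point d"
          using surj by (metis UNIV_I image_iff)
        then have "{c, d} \<in> ?P" using pq by blast
        then have "code_point ` {c, d} \<in> (image code_point) ` ?P" by (rule imageI)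
        then show "e \<in> (image code_point) ` ?P" using pq cd by simp
      qed
    qed
  qed
  from bij_betw_trans[OF pairs_bij[OF check_distinct(2)] this]
  have "bij_betw (image code_point \<circ> (\<lambda>(x, y). {x, y})) (set pair_codes) Pairs" by (simp add: pair_codes_def)
  moreover have "image code_point \<circ> (\<lambda>(x, y). {x, y}) = pair_of"
    by (auto simp: fun_eq_iff pair_of_def)
  ultimately show ?thesis by simp
qed

text \<open>The two products of determinants in \<open>harmonic\<close> add up to the polarization of the
  discriminant, where the coefficients \<open>2\<close> become \<open>-1\<close>.\<close>

lemma harmonic_polar:
  "harmonic p q r s \<longleftrightarrow>
    (rep p $ 2 * rep q $ 2) * (rep r $ 1 * rep s $ 1) + (rep p $ 1 * rep q $ 1) * (rep r $ 2 * rep s $ 2)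
    + (rep p $ 1 * rep q $ 2 + rep q $ 1 * rep p $ 2) * (rep r $ 1 * rep s $ 2 + rep s $ 1 * rep r $ 2) = 0"
  (is "_ \<longleftrightarrow> ?A + ?C + ?B = 0")
proof -
  have "harmonic p q r s \<longleftrightarrow> (?A + ?A) + (?C + ?C) - ?B = 0"
    by (simp add: harmonic_def det2_def algebra_simps)
  also have "\<dots> \<longleftrightarrow> - (?A + ?C + ?B) = 0"
    unfolding gf9_double by (simp add: algebra_simps)
  finally show ?thesis by (simp only: neg_equal_0_iff_equal)
qed

definition code_adj :: "code \<times> code \<Rightarrow> code \<times> code \<Rightarrow> bool" where
  "code_adj l m \<longleftrightarrow> polar_zero (pair_form l) (pair_form m)"

lemma conjugate_pair_of:
  assumes "l \<in> set pair_codes" "m \<in> set pair_codes"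
  shows "conjugate (pair_of l) (pair_of m) \<longleftrightarrow> code_adj l m"
proof -
  obtain c d where l: "l = (c, d)" "c \<in> set point_codes" "d \<in> set point_codes" "code_point c \<noteq> code_point d"
    using assms(1) by (rule pair_codes_cases)
  obtain c' d' where m: "m = (c', d')" "c' \<in> set point_codes" "d' \<in> set point_codes" "code_point c' \<noteq> code_point d'"
    using assms(2) by (rule pair_codes_cases)
  have "conjugate (pair_of l) (pair_of m) \<longleftrightarrow> harmonic (code_point c) (code_point d) (code_point c') (code_point d')"
    using l m by (simp add: pair_of_def conjugate_iff)
  also have "\<dots> \<longleftrightarrow> code_adj l m"
    unfolding harmonic_polar code_adj_def l(1) m(1)
    using rep_code_point[OF l(2)] rep_code_point[OF l(3)] rep_code_point[OF m(2)] rep_code_point[OF m(3)]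
    by (cases c; cases d; cases c'; cases d') (simp add: gzero_iff gf9_of_gadd gf9_of_gmul)
  finally show ?thesis .
qed

section \<open>Decoding flags\<close>

definition vec_of_word :: "word4 \<Rightarrow> bit ^ 4" where
  "vec_of_word w = (case w of (a, b, c, d) \<Rightarrow> \<chi> i. of_bool (if i = 1 then a else if i = 2 then b else if i = 3 then c else d))"

lemma vec_of_word_nth: "vec_of_word (a, b, c, d) $ 1 = of_bool a" "vec_of_word (a, b, c, d) $ 2 = of_bool b"
  "vec_of_word (a, b, c, d) $ 3 = of_bool c" "vec_of_word (a, b, c, d) $ 4 = of_bool d"
  by (simp_all add: vec_of_word_def)

lemma vec4_eq_iff: "u = v \<longleftrightarrow> u $ 1 = v $ 1 \<and> u $ 2 = v $ 2 \<and> u $ 3 = v $ 3 \<and> u $ 4 = v $ 4" for u v :: "'a ^ 4"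
  by (simp add: vec_eq_iff forall_4)

lemma vec_of_word_inj: "vec_of_word x = vec_of_word y \<longleftrightarrow> x = y"
  by (cases x; cases y) (auto simp: vec4_eq_iff vec_of_word_nth)

lemma vec_of_word_zero_word: "vec_of_word zero_word = 0"
  by (simp add: zero_word_def vec4_eq_iff vec_of_word_nth)

lemma vec_of_word_eq_0: "vec_of_word x = 0 \<longleftrightarrow> x = zero_word"
  using vec_of_word_inj[of x zero_word] by (simp add: vec_of_word_zero_word)

lemma of_bool_xor: "(of_bool (a \<noteq> b) :: bit) = of_bool a + of_bool b"
  by (cases a; cases b) auto

lemma vec_of_word_wadd: "vec_of_word (wadd x y) = vec_of_word x + vec_of_word y"
proof -
  obtain a b c d a' b' c' d' where "x = (a, b, c, d)" "y = (a', b', c', d')"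
    by (metis prod_cases4)
  then show ?thesis
    by (simp only: wadd.simps vec4_eq_iff vec_of_word_nth vector_add_component of_bool_xor)
qed

lemma symp_vec_of_word: "symp_form (vec_of_word x) (vec_of_word y) = of_bool (wsymp x y)"
proof -
  obtain a b c d a' b' c' d' where "x = (a, b, c, d)" "y = (a', b', c', d')"
    by (metis prod_cases4)
  then show ?thesis
    by (simp only: symp_form_def vec_of_word_nth minus_bit_def of_bool_conj[symmetric]
      of_bool_xor[symmetric] wsymp.simps)
qed

lemma vec_of_word_surj: "\<exists>w. v = vec_of_word w"
proof
  have "of_bool (x = 1) = x" for x :: bit by (cases x) auto
  then show "v = vec_of_word (v $ 1 = 1, v $ 2 = 1, v $ 3 = 1, v $ 4 = 1)"
    by (simp only: vec4_eq_iff vec_of_word_nth)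
qed

lemma words_all: "w \<in> set words"
proof -
  have "a \<in> set [False, True]" for a by (cases a) simp_all
  then show ?thesis by (cases w) (simp only: words_def Let_def set_product mem_Sigma_iff)
qed

section \<open>The symplectic quadrangle\<close>

lemma bit4_add_self [simp]: "x + x = 0" for x :: "bit ^ 4"
  by (simp add: vec_eq_iff)

lemma bit4_cancel [simp]: "x + (x + y) = y" for x y :: "bit ^ 4"
  by (simp add: add.assoc[symmetric])

lemma ex_bit: "(\<exists>k::bit. P k) \<longleftrightarrow> P 0 \<or> P 1"
  by (metis (full_types) bit_not_one_iff)

lemma bit_range: "range (\<lambda>k::bit. k *s v) = {0, v}" for v :: "bit ^ 4"
  by (auto simp: image_iff ex_bit)

lemma span_single: "vec.span {v} = {0, v}" for v :: "bit ^ 4"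
  unfolding vec.span_singleton by (rule bit_range)

lemma span_pair: "vec.span {u, v} = {0, u, v, u + v}" for u v :: "bit ^ 4"
proof -
  have "vec.span {u, v} = {x. \<exists>k::bit. x - k *s u \<in> {0, v}}"
    unfolding vec.span_insert[of u] span_single ..
  also have "\<dots> = {x. x - 0 *s u \<in> {0, v} \<or> x - 1 *s u \<in> {0, v}}"
    unfolding ex_bit ..
  also have "\<dots> = {0, u, v, u + v}"
    by (simp only: vector_smult_lzero vector_smult_lid insert_iff empty_iff diff_eq_eq diff_0_right)
      (auto simp: add.commute)
  finally show ?thesis .
qed

lemma W2_points_iff: "P \<in> W2_points \<longleftrightarrow> (\<exists>v. v \<noteq> 0 \<and> P = {0, v})"
proof
  assume P: "P \<in> W2_points"
  obtain B where B: "B \<subseteq> P" "vec.independent B" "P \<subseteq> vec.span B" "card B = vec.dim P"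
    using vec.basis_exists by blast
  have sub: "vec.subspace P" and "card B = 1" using P B by (simp_all add: W2_points_def)
  then obtain v where v: "B = {v}" by (auto simp: card_1_singleton_iff)
  have "v \<noteq> 0" using B(2) v vec.dependent_single by blast
  moreover have "P = vec.span B" using vec.span_subspace[OF B(1,3) sub] by simp
  ultimately show "\<exists>v. v \<noteq> 0 \<and> P = {0, v}" using v span_single by blast
next
  assume "\<exists>v. v \<noteq> 0 \<and> P = {0, v}"
  then obtain v where v: "v \<noteq> 0" "P = vec.span {v}" using span_single by blast
  have ind: "vec.independent {v}" using v by (simp add: vec.dependent_single)
  show "P \<in> W2_points"
    using vec.dim_span_eq_card_independent[OF ind] vec.subspace_span v by (simp add: W2_points_def)
qed

lemma symp_props:
  "symp_form x x = 0" "symp_form 0 x = 0" "symp_form x 0 = 0"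
  "symp_form (x + y) z = symp_form x z + symp_form y z"
  "symp_form x (y + z) = symp_form x y + symp_form x z"
  "symp_form y x = symp_form x y"
proof -
  show "symp_form x x = 0" "symp_form 0 x = 0" "symp_form x 0 = 0"
    by (simp_all only: symp_form_def zero_index mult_zero_left mult_zero_right mult.commute diff_self add_0)
  show "symp_form (x + y) z = symp_form x z + symp_form y z"
    "symp_form x (y + z) = symp_form x y + symp_form x z"
    by (simp_all only: symp_form_def vector_add_component algebra_simps)
  show "symp_form y x = symp_form x y"
    by (simp only: symp_form_def minus_bit_def ac_simps)
qed

lemma W2_lines_iff: "L \<in> W2_lines \<longleftrightarrow>
  (\<exists>u v. u \<noteq> 0 \<and> v \<noteq> 0 \<and> u \<noteq> v \<and> symp_form u v = 0 \<and> L = {0, u, v, u + v})"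
proof
  assume L: "L \<in> W2_lines"
  obtain B where B: "B \<subseteq> L" "vec.independent B" "L \<subseteq> vec.span B" "card B = vec.dim L"
    using vec.basis_exists by blast
  have sub: "vec.subspace L" and "card B = 2" using L B by (simp_all add: W2_lines_def)
  then obtain u v where uv: "B = {u, v}" "u \<noteq> v" by (auto simp: card_2_iff)
  have "u \<noteq> 0" "v \<noteq> 0" using B(2) uv vec.dependent_zero by blast+
  moreover have "L = vec.span B" using vec.span_subspace[OF B(1,3) sub] by simp
  moreover have "symp_form u v = 0" using L B(1) uv by (simp add: W2_lines_def)
  ultimately show "\<exists>u v. u \<noteq> 0 \<and> v \<noteq> 0 \<and> u \<noteq> v \<and> symp_form u v = 0 \<and> L = {0, u, v, u + v}"
    using uv span_pair by blast
next
  assume "\<exists>u v. u \<noteq> 0 \<and> v \<noteq> 0 \<and> u \<noteq> v \<and> symp_form u v = 0 \<and> L = {0, u, v, u + v}"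
  then obtain u v where uv: "u \<noteq> 0" "v \<noteq> 0" "u \<noteq> v" "symp_form u v = 0" "L = {0, u, v, u + v}"
    by blast
  have ind: "vec.independent {u, v}"
    using uv by (simp add: vec.independent_insert span_single vec.dependent_single)
  have "symp_form v u = 0" using uv(4) symp_props(6) by metis
  then have "\<forall>x\<in>L. \<forall>y\<in>L. symp_form x y = 0"
    unfolding uv(5) using uv(4) by (simp add: symp_props(1-5))
  then show "L \<in> W2_lines"
    using vec.dim_span_eq_card_independent[OF ind] vec.subspace_span[of "{u, v}"] uv(3,5)
    by (simp add: W2_lines_def span_pair)
qed

definition flag :: "bit ^ 4 \<Rightarrow> bit ^ 4 \<Rightarrow> ((bit ^ 4) set + (bit ^ 4) set) set" where
  "flag v u = {Inl {0, v}, Inr {0, v, u, v + u}}"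

text \<open>An edge is a flag of \<open>W(2)\<close>, and the second generator of its line can be chosen
  freely outside its point.\<close>

lemma sedges_Tutte_Coxeter:
  "sedges Tutte_Coxeter = {flag v u | v u. v \<noteq> 0 \<and> u \<noteq> 0 \<and> u \<noteq> v \<and> symp_form v u = 0}"
proof
  show "sedges Tutte_Coxeter \<subseteq> {flag v u | v u. v \<noteq> 0 \<and> u \<noteq> 0 \<and> u \<noteq> v \<and> symp_form v u = 0}"
  proof
    fix e assume "e \<in> sedges Tutte_Coxeter"
    then obtain P L where e: "e = {Inl P, Inr L}" and PL: "P \<in> W2_points" "L \<in> W2_lines" "P \<subseteq> L"
      by (auto simp: Tutte_Coxeter_def incidence_graph_def)
    obtain v where v: "v \<noteq> 0" "P = {0, v}" using PL(1) unfolding W2_points_iff by blast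
    obtain a b where ab: "a \<noteq> 0" "b \<noteq> 0" "a \<noteq> b" "symp_form a b = 0" "L = {0, a, b, a + b}"
      using PL(2) unfolding W2_lines_iff by blast
    have "v = a \<or> v = b \<or> v = a + b" using PL(3) v ab(5) by auto
    then have "\<exists>u. u \<noteq> 0 \<and> u \<noteq> v \<and> symp_form v u = 0 \<and> L = {0, v, u, v + u}"
    proof (elim disjE)
      assume "v = a" then show ?thesis using ab by blast
    next
      assume "v = b"
      moreover have "symp_form b a = 0" using ab(4) symp_props(6) by metis
      ultimately show ?thesis using ab by (intro exI[of _ a]) (auto simp: add.commute)
    next
      assume v_eq: "v = a + b"
      have "symp_form v a = 0" using ab(4) symp_props(6)[of a b] by (simp add: v_eq symp_props(1,4))
      moreover have "a \<noteq> v" using ab(2) v_eq by simp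
      moreover have "v + a = b" by (simp add: v_eq add.commute)
      ultimately show ?thesis using ab by (intro exI[of _ a]) (auto simp: v_eq)
    qed
    then show "e \<in> {flag v u | v u. v \<noteq> 0 \<and> u \<noteq> 0 \<and> u \<noteq> v \<and> symp_form v u = 0}"
      using e v unfolding flag_def by blast
  qed
  show "{flag v u | v u. v \<noteq> 0 \<and> u \<noteq> 0 \<and> u \<noteq> v \<and> symp_form v u = 0} \<subseteq> sedges Tutte_Coxeter"
  proof
    fix e assume "e \<in> {flag v u | v u. v \<noteq> 0 \<and> u \<noteq> 0 \<and> u \<noteq> v \<and> symp_form v u = 0}"
    then obtain v u where vu: "v \<noteq> 0" "u \<noteq> 0" "u \<noteq> v" "symp_form v u = 0" "e = flag v u" by blast
    have "{0, v} \<in> W2_points" using vu W2_points_iff by blast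
    moreover have "{0, v, u, v + u} \<in> W2_lines" using vu W2_lines_iff by blast
    ultimately show "e \<in> sedges Tutte_Coxeter"
      by (auto simp: Tutte_Coxeter_def incidence_graph_def vu(5) flag_def)
  qed
qed

definition flag_of :: "code \<times> code \<Rightarrow> ((bit ^ 4) set + (bit ^ 4) set) set" where
  "flag_of l = (case flag_code l of (v, ws) \<Rightarrow> {Inl {0, vec_of_word v}, Inr (vec_of_word ` set ws)})"

lemma vec_of_word_line_words: "vec_of_word ` set (line_words v u) = {0, vec_of_word v, vec_of_word u, vec_of_word v + vec_of_word u}"
proof -
  have "set (line_words v u) = {zero_word, v, u, wadd v u}"
    using words_all by (auto simp: line_words_def)
  then show ?thesis by (simp add: vec_of_word_zero_word vec_of_word_wadd)
qed

lemma pair_codes_flag: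
  assumes "l \<in> set pair_codes"
  obtains v u where "flag_code l = (v, line_words v u)" "v \<noteq> zero_word" "u \<noteq> zero_word" "u \<noteq> v" "\<not> wsymp v u"
proof -
  obtain v ws where l: "flag_code l = (v, ws)" by (cases "flag_code l")
  have "(v, ws) \<in> set (map flag_code pair_codes)" using assms l by force
  then have "v \<noteq> zero_word \<and> (\<exists>u\<in>set words. u \<noteq> zero_word \<and> u \<noteq> v \<and> \<not> wsymp v u \<and> ws = line_words v u)"
    using check_valid unfolding list_all_iff list_ex_iff by blast
  then show ?thesis using that l by blast
qed

text \<open>Both lists are filtered from \<open>words\<close>, hence determined by their sets.\<close>

lemma line_words_eq: "line_words v u = line_words v' u' \<longleftrightarrow> vec_of_word ` set (line_words v u) = vec_of_word ` set (line_words v' u')"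
proof
  assume "vec_of_word ` set (line_words v u) = vec_of_word ` set (line_words v' u')"
  then have eq: "set (line_words v u) = set (line_words v' u')"
    using inj_image_eq_iff[of vec_of_word] vec_of_word_inj by (metis injI)
  show "line_words v u = line_words v' u'"
    unfolding line_words_def by (rule filter_cong[OF refl]) (use eq in \<open>auto simp: line_words_def\<close>)
qed simp

lemma
  assumes "l \<in> set pair_codes" "m \<in> set pair_codes"
  shows flag_of_eq: "flag_of l = flag_of m \<longleftrightarrow> flag_code l = flag_code m"
    and flag_of_adj: "flag_of l \<noteq> flag_of m \<and> flag_of l \<inter> flag_of m \<noteq> {} \<longleftrightarrow> flag_touch (flag_code l) (flag_code m)"
proof -
  obtain v u where l: "flag_code l = (v, line_words v u)" "v \<noteq> zero_word" using assms(1) by (rule pair_codes_flag)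
  obtain v' u' where m: "flag_code m = (v', line_words v' u')" "v' \<noteq> zero_word" using assms(2) by (rule pair_codes_flag)
  have p: "{0, vec_of_word v} = {0, vec_of_word v'} \<longleftrightarrow> v = v'"
    using l(2) m(2) by (auto simp: doubleton_eq_iff vec_of_word_inj vec_of_word_eq_0)
  show "flag_of l = flag_of m \<longleftrightarrow> flag_code l = flag_code m"
    "flag_of l \<noteq> flag_of m \<and> flag_of l \<inter> flag_of m \<noteq> {} \<longleftrightarrow> flag_touch (flag_code l) (flag_code m)"
    unfolding flag_of_def l(1) m(1) prod.case flag_touch.simps prod.inject line_words_eq p[symmetric]
    by (auto simp: doubleton_eq_iff)
qed

lemma flag_of_bij: "bij_betw flag_of (set pair_codes) (sedges Tutte_Coxeter)"
  unfolding bij_betw_def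
proof
  have inj: "inj_on flag_code (set pair_codes)" using check_distinct(1) unfolding distinct_map by blast
  show "inj_on flag_of (set pair_codes)"
  proof (rule inj_onI)
    fix l m assume "l \<in> set pair_codes" "m \<in> set pair_codes" "flag_of l = flag_of m"
    then show "l = m" using flag_of_eq[of l m] inj_onD[OF inj, of l m] by blast
  qed
  show "flag_of ` set pair_codes = sedges Tutte_Coxeter"
  proof
    show "flag_of ` set pair_codes \<subseteq> sedges Tutte_Coxeter"
    proof (rule image_subsetI)
      fix l assume "l \<in> set pair_codes"
      then obtain v u where l: "flag_code l = (v, line_words v u)" "v \<noteq> zero_word" "u \<noteq> zero_word" "u \<noteq> v" "\<not> wsymp v u"
        by (rule pair_codes_flag)
      have "flag_of l = flag (vec_of_word v) (vec_of_word u)"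
        by (simp add: flag_of_def l(1) vec_of_word_line_words flag_def)
      then show "flag_of l \<in> sedges Tutte_Coxeter"
        unfolding sedges_Tutte_Coxeter
        using l(2-5) vec_of_word_eq_0[of v] vec_of_word_eq_0[of u] vec_of_word_inj[of u v] symp_vec_of_word[of v u]
        unfolding mem_Collect_eq by (intro exI conjI) simp_all
    qed
    show "sedges Tutte_Coxeter \<subseteq> flag_of ` set pair_codes"
    proof
      fix e assume "e \<in> sedges Tutte_Coxeter"
      then obtain v' u' where e: "v' \<noteq> 0" "u' \<noteq> 0" "u' \<noteq> v'" "symp_form v' u' = 0" "e = flag v' u'"
        unfolding sedges_Tutte_Coxeter by blast
      obtain v u where vu: "v' = vec_of_word v" "u' = vec_of_word u" using vec_of_word_surj by metis
      have "v \<noteq> zero_word" "u \<noteq> zero_word" "u \<noteq> v" "\<not> wsymp v u"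
        using e(1-4) unfolding vu symp_vec_of_word vec_of_word_eq_0 vec_of_word_inj by auto
      then have "List.member (map flag_code pair_codes) (v, line_words v u)"
        using check_surj words_all unfolding list_all_iff by blast
      then obtain l where l: "l \<in> set pair_codes" "flag_code l = (v, line_words v u)"
        unfolding List.member_iff set_map by (metis imageE)
      have "flag_of l = e" using l(2) by (simp add: flag_of_def vec_of_word_line_words flag_def e(5) vu)
      then show "e \<in> flag_of ` set pair_codes" using l(1) by blast
    qed
  qed
qed

section \<open>The line graph of the Tutte-Coxeter graph\<close>

type_synonym tc_edge = "((bit ^ 4) set + (bit ^ 4) set) set"

definition Flags :: "tc_edge set" where
  "Flags = sverts (line_graph Tutte_Coxeter)"

definition Auts :: "(tc_edge \<Rightarrow> tc_edge) set" where
  "Auts = graph_aut (line_graph Tutte_Coxeter)"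

definition adj :: "tc_edge \<Rightarrow> tc_edge \<Rightarrow> bool" where
  "adj x y \<longleftrightarrow> {x, y} \<in> sedges (line_graph Tutte_Coxeter)"

lemma Flags_eq: "Flags = sedges Tutte_Coxeter"
  by (simp add: Flags_def line_graph_def)

lemma adj_iff: "adj x y \<longleftrightarrow> x \<in> Flags \<and> y \<in> Flags \<and> x \<noteq> y \<and> x \<inter> y \<noteq> {}"
  unfolding adj_def Flags_eq line_graph_def by (auto simp: doubleton_eq_iff)

lemma mem_Auts: "p \<in> Auts \<longleftrightarrow> p permutes Flags \<and> (\<forall>u\<in>Flags. \<forall>v\<in>Flags. adj u v \<longleftrightarrow> adj (p u) (p v))"
  by (simp add: Auts_def graph_aut_def Flags_def adj_def)

lemma flag_of_bij_Flags: "bij_betw flag_of (set pair_codes) Flags"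
  unfolding Flags_eq by (rule flag_of_bij)

lemma check_adj_iff:
  assumes "l \<in> set pair_codes" "m \<in> set pair_codes"
  shows "code_adj l m \<longleftrightarrow> flag_touch (flag_code l) (flag_code m)"
proof -
  have "(pair_form l, flag_code l) \<in> set (map (\<lambda>l. (pair_form l, flag_code l)) pair_codes)"
    "(pair_form m, flag_code m) \<in> set (map (\<lambda>l. (pair_form l, flag_code l)) pair_codes)"
    unfolding set_map using assms by blast+
  then show ?thesis using check_adj unfolding list_all_iff code_adj_def by blast
qed

lemma adj_flag_of:
  assumes "l \<in> set pair_codes" "m \<in> set pair_codes"
  shows "adj (flag_of l) (flag_of m) \<longleftrightarrow> code_adj l m"
proof -
  have "flag_of l \<in> Flags" "flag_of m \<in> Flags" using bij_betwE[OF flag_of_bij_Flags] assms by blast+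
  then have "adj (flag_of l) (flag_of m) \<longleftrightarrow> flag_touch (flag_code l) (flag_code m)"
    unfolding adj_iff flag_of_adj[OF assms, symmetric] by blast
  also have "\<dots> \<longleftrightarrow> code_adj l m"
    using check_adj_iff[OF assms] by simp
  finally show ?thesis .
qed

definition flag_of_pair :: "pt set \<Rightarrow> tc_edge" where
  "flag_of_pair = flag_of \<circ> inv_into (set pair_codes) pair_of"

lemma bij_flag_of_pair: "bij_betw flag_of_pair Pairs Flags"
  unfolding flag_of_pair_def by (rule bij_betw_trans[OF bij_betw_inv_into[OF pair_of_bij] flag_of_bij_Flags])

lemma flag_of_pair_of_code: "l \<in> set pair_codes \<Longrightarrow> flag_of_pair (pair_of l) = flag_of l"
  unfolding flag_of_pair_def comp_apply bij_betw_inv_into_left[OF pair_of_bij] ..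

lemma adj_flag_of_pair:
  assumes "e \<in> Pairs" "f \<in> Pairs"
  shows "adj (flag_of_pair e) (flag_of_pair f) \<longleftrightarrow> conjugate e f"
proof -
  have "e \<in> pair_of ` set pair_codes" "f \<in> pair_of ` set pair_codes"
    unfolding bij_betw_imp_surj_on[OF pair_of_bij] by (rule assms)+
  then obtain l m where lm: "l \<in> set pair_codes" "e = pair_of l" "m \<in> set pair_codes" "f = pair_of m" by blast
  show ?thesis
    unfolding lm(2,4) flag_of_pair_of_code[OF lm(1)] flag_of_pair_of_code[OF lm(3)] adj_flag_of[OF lm(1,3)]
      conjugate_pair_of[OF lm(1,3)] ..
qed

lemma flag_of_pair_in: "e \<in> Pairs \<Longrightarrow> flag_of_pair e \<in> Flags"
  using bij_betwE[OF bij_flag_of_pair] by blast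

lemma flag_of_pair_eq_iff: "e \<in> Pairs \<Longrightarrow> f \<in> Pairs \<Longrightarrow> flag_of_pair e = flag_of_pair f \<longleftrightarrow> e = f"
  using inj_on_eq_iff[OF bij_betw_imp_inj_on[OF bij_flag_of_pair]] .

lemma Flags_cases:
  assumes "x \<in> Flags" obtains e where "e \<in> Pairs" "x = flag_of_pair e"
  using assms bij_betw_imp_surj_on[OF bij_flag_of_pair] by blast

section \<open>The automorphism group\<close>

definition induced :: "(gf9 ^ 2 \<Rightarrow> gf9 ^ 2) \<Rightarrow> tc_edge \<Rightarrow> tc_edge" where
  "induced T x = (if x \<in> Flags then flag_of_pair (act T ` inv_into Pairs flag_of_pair x) else x)"

lemma induced_flag_of_pair: "e \<in> Pairs \<Longrightarrow> induced T (flag_of_pair e) = flag_of_pair (act T ` e)"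
  by (simp add: induced_def flag_of_pair_in bij_betw_inv_into_left[OF bij_flag_of_pair])

lemma induced_outside: "x \<notin> Flags \<Longrightarrow> induced T x = x"
  by (simp add: induced_def)

lemma induced_comp:
  assumes "S \<in> \<Gamma>" "T \<in> \<Gamma>"
  shows "induced (S \<circ> T) = induced S \<circ> induced T"
proof
  fix x
  show "induced (S \<circ> T) x = (induced S \<circ> induced T) x"
  proof (cases "x \<in> Flags")
    case True
    then obtain e where e: "e \<in> Pairs" "x = flag_of_pair e" by (rule Flags_cases)
    then show ?thesis
      using image_in_Pairs[OF assms(2)] by (simp add: induced_flag_of_pair act_comp[OF assms] image_comp)
  qed (simp add: induced_outside)
qed

lemma induced_id: "induced id = id"
proof
  fix x show "induced id x = id x"
  proof (cases "x \<in> Flags")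
    case True
    then obtain e where "e \<in> Pairs" "x = flag_of_pair e" by (rule Flags_cases)
    then show ?thesis by (simp add: induced_flag_of_pair)
  qed (simp add: induced_outside)
qed

lemma induced_inv:
  assumes "T \<in> \<Gamma>"
  shows "induced (inv_into UNIV T) \<circ> induced T = id" "induced T \<circ> induced (inv_into UNIV T) = id"
proof -
  have "bij T" using assms unfolding mem_Gamma by blast
  then have 1: "inv_into UNIV T \<circ> T = id" and 2: "T \<circ> inv_into UNIV T = id"
    by (simp_all add: bij_is_inj bij_is_surj surj_iff[symmetric])
  show "induced (inv_into UNIV T) \<circ> induced T = id" "induced T \<circ> induced (inv_into UNIV T) = id"
    unfolding induced_comp[OF inv_in_Gamma[OF assms] assms, symmetric]
      induced_comp[OF assms inv_in_Gamma[OF assms], symmetric] 1 2 by (rule induced_id)+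
qed

lemma induced_in_Auts:
  assumes T: "T \<in> \<Gamma>"
  shows "induced T \<in> Auts"
  unfolding mem_Auts
proof
  have "bij (induced T)" using induced_inv[OF T] by (rule o_bij)
  then show "induced T permutes Flags"
    by (simp add: permutes_def bij_iff induced_outside)
  show "\<forall>u\<in>Flags. \<forall>v\<in>Flags. adj u v \<longleftrightarrow> adj (induced T u) (induced T v)"
  proof (intro ballI)
    fix u v assume "u \<in> Flags" "v \<in> Flags"
    then obtain e f where ef: "e \<in> Pairs" "u = flag_of_pair e" "f \<in> Pairs" "v = flag_of_pair f" by (meson Flags_cases)
    then show "adj u v \<longleftrightarrow> adj (induced T u) (induced T v)"
      using image_in_Pairs[OF T] by (simp add: induced_flag_of_pair adj_flag_of_pair conjugate_image[OF T])
  qed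
qed

text \<open>Transported to pairs, an automorphism of the line graph preserves harmonic conjugacy, so it comes
  from a semilinear map by \<open>automorphism_semilinear\<close>.\<close>

lemma Auts_eq_induced: "Auts = induced ` \<Gamma>"
proof
  show "induced ` \<Gamma> \<subseteq> Auts" using induced_in_Auts by blast
  show "Auts \<subseteq> induced ` \<Gamma>"
  proof
    fix p assume p: "p \<in> Auts"
    then have perm: "p permutes Flags" and pres: "\<And>u v. u \<in> Flags \<Longrightarrow> v \<in> Flags \<Longrightarrow> adj (p u) (p v) \<longleftrightarrow> adj u v"
      unfolding mem_Auts by blast+
    define \<psi> where "\<psi> = inv_into Pairs flag_of_pair \<circ> p \<circ> flag_of_pair"
    have bij: "bij_betw \<psi> Pairs Pairs"
      unfolding \<psi>_def comp_assoc
      by (rule bij_betw_trans[OF bij_betw_trans[OF bij_flag_of_pair permutes_imp_bij[OF perm]] bij_betw_inv_into[OF bij_flag_of_pair]])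
    have flag_\<psi>: "flag_of_pair (\<psi> e) = p (flag_of_pair e)" if "e \<in> Pairs" for e
    proof -
      have "p (flag_of_pair e) \<in> Flags" using flag_of_pair_in[OF that] perm by (simp add: permutes_in_image)
      then show ?thesis by (simp add: \<psi>_def bij_betw_inv_into_right[OF bij_flag_of_pair])
    qed
    have \<psi>Pairs: "\<psi> e \<in> Pairs" if "e \<in> Pairs" for e using bij_betwE[OF bij] that by blast
    have "conjugate (\<psi> e) (\<psi> f) \<longleftrightarrow> conjugate e f" if "e \<in> Pairs" "f \<in> Pairs" for e f
      using pres[OF flag_of_pair_in[OF that(1)] flag_of_pair_in[OF that(2)]] that
      by (simp add: adj_flag_of_pair[symmetric] \<psi>Pairs flag_\<psi>)
    with bij have "\<exists>T\<in>\<Gamma>. \<forall>e\<in>Pairs. \<psi> e = act T ` e" by (rule automorphism_semilinear)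
    then obtain T where T: "T \<in> \<Gamma>" "\<And>e. e \<in> Pairs \<Longrightarrow> \<psi> e = act T ` e" by blast
    have "p x = induced T x" for x
    proof (cases "x \<in> Flags")
      case True
      then obtain e where e: "e \<in> Pairs" "x = flag_of_pair e" by (rule Flags_cases)
      have "p x = flag_of_pair (\<psi> e)" using flag_\<psi>[OF e(1)] e(2) by simp
      also have "\<dots> = induced T x" using T(2)[OF e(1)] e by (simp add: induced_flag_of_pair)
      finally show ?thesis .
    next
      case False
      then show ?thesis using perm by (simp add: induced_outside permutes_not_in)
    qed
    then have "p = induced T" by (rule ext)
    then show "p \<in> induced ` \<Gamma>" using T(1) by blast
  qed
qed

text \<open>A point is the only common element of two pairs through it.\<close>

lemma induced_eq_id:
  assumes T: "T \<in> \<Gamma>" and "induced T = id"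
  shows "act T = id"
proof -
  have fixed: "act T ` e = e" if "e \<in> Pairs" for e
    using induced_flag_of_pair[OF that, of T] assms(2) flag_of_pair_eq_iff[OF image_in_Pairs[OF T that] that] by simp
  have "act T p = p" for p
  proof -
    have "card {p} < 5" by simp
    then obtain q where q: "q \<noteq> p" using fresh_point[of "{p}"] by auto
    have "card {p, q} < 5" by (simp add: card_insert_if)
    then obtain r where r: "r \<notin> {p, q}" using fresh_point[of "{p, q}"] by auto
    have "p \<noteq> q" "p \<noteq> r" using q r by auto
    from this[THEN Pairs_I, THEN fixed]
    have "{act T p, act T q} = {p, q}" "{act T p, act T r} = {p, r}"
      by (simp_all only: image_insert image_empty)
    then show ?thesis using q r by (auto simp: doubleton_eq_iff)
  qed
  then show ?thesis by (simp add: fun_eq_iff)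
qed

lemma group_Auts: "group (perm_grp Auts)"
proof (rule group_perm_grp)
  show "id \<in> Auts" unfolding Auts_eq_induced using induced_id id_in_Gamma by (metis imageI)
  show "f \<circ> g \<in> Auts" if "f \<in> Auts" "g \<in> Auts" for f g
    using that unfolding Auts_eq_induced by (metis (no_types, lifting) comp_in_Gamma image_iff induced_comp)
  show "\<exists>g\<in>Auts. g \<circ> f = id" if "f \<in> Auts" for f
    using that induced_inv inv_in_Gamma unfolding Auts_eq_induced by blast
qed

text \<open>The homomorphism \<open>induced\<close> is onto, and its kernel consists of the scalars.\<close>

theorem perm_grp_Auts_iso: "perm_grp Auts \<cong> (PGammaL :: (gf9 ^ 2 \<Rightarrow> gf9 ^ 2) set monoid)"
proof -
  have mult: "f \<otimes>\<^bsub>GammaL\<^esub> g = f \<circ> g" for f g :: "gf9 ^ 2 \<Rightarrow> gf9 ^ 2"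
    by (simp add: GammaL_def perm_grp_def)
  interpret group_hom "GammaL :: (gf9 ^ 2 \<Rightarrow> gf9 ^ 2) monoid" "perm_grp Auts" induced
  proof (intro group_hom.intro group_hom_axioms.intro group_GammaL group_Auts)
    show "induced \<in> hom GammaL (perm_grp Auts)"
      by (rule homI) (simp_all add: mult perm_grp_def induced_in_Auts induced_comp)
  qed
  have "kernel GammaL (perm_grp Auts) induced = scalar_maps"
  proof
    show "kernel GammaL (perm_grp Auts) induced \<subseteq> scalar_maps"
      using induced_eq_id act_eq_id_imp_scalar by (auto simp: kernel_def perm_grp_def)
    show "scalar_maps \<subseteq> kernel GammaL (perm_grp Auts) induced"
    proof
      fix T :: "gf9 ^ 2 \<Rightarrow> gf9 ^ 2" assume T: "T \<in> scalar_maps"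
      have "induced T = induced id" unfolding induced_def scalar_in_Gamma(2)[OF T] act_id ..
      then show "T \<in> kernel GammaL (perm_grp Auts) induced"
        using scalar_in_Gamma(1)[OF T] by (simp add: kernel_def perm_grp_def induced_id)
    qed
  qed
  moreover have "induced ` carrier GammaL = carrier (perm_grp Auts)"
    by (simp add: perm_grp_def Auts_eq_induced)
  ultimately have "(\<lambda>A. the_elem (induced ` A)) \<in> iso PGammaL (perm_grp Auts)"
    unfolding PGammaL_def using FactGroup_iso_set by simp
  moreover have "group (PGammaL :: (gf9 ^ 2 \<Rightarrow> gf9 ^ 2) set monoid)"
    unfolding PGammaL_def using \<open>kernel GammaL (perm_grp Auts) induced = scalar_maps\<close> normal_kernel
    by (metis normal.factorgroup_is_group)
  ultimately show ?thesis by (meson group.iso_sym is_isoI)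
qed

section \<open>Primitivity\<close>

lemma is_perm_group_Auts: "is_perm_group Flags Auts"
  unfolding is_perm_group_def
proof -
  let ?S = "perm_grp {p. p permutes Flags}"
  have S: "group ?S"
  proof (rule group_perm_grp)
    show "\<exists>g\<in>{p. p permutes Flags}. g \<circ> f = id" if "f \<in> {p. p permutes Flags}" for f
      using that permutes_inv_o(2) permutes_inv by blast
  qed (simp_all add: permutes_id permutes_compose)
  show "subgroup Auts ?S"
  proof (rule group.subgroupI[OF S])
    show "Auts \<subseteq> carrier ?S" by (auto simp: perm_grp_def mem_Auts)
    show "Auts \<noteq> {}" using induced_in_Auts[OF id_in_Gamma] by blast
    show "f \<otimes>\<^bsub>?S\<^esub> g \<in> Auts" if "f \<in> Auts" "g \<in> Auts" for f g
      using group.is_monoid[OF group_Auts, THEN monoid.m_closed, of f g] that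
      by (simp add: perm_grp_def)
    show "m_inv ?S f \<in> Auts" if f: "f \<in> Auts" for f
    proof -
      obtain T where T: "T \<in> \<Gamma>" "f = induced T" using f unfolding Auts_eq_induced by blast
      have "m_inv ?S f = induced (inv_into UNIV T)"
      proof (rule group.inv_equality[OF S])
        show "induced (inv_into UNIV T) \<otimes>\<^bsub>?S\<^esub> f = \<one>\<^bsub>?S\<^esub>"
          using induced_inv(1)[OF T(1)] by (simp add: perm_grp_def T(2))
        show "f \<in> carrier ?S" "induced (inv_into UNIV T) \<in> carrier ?S"
          using f induced_in_Auts[OF inv_in_Gamma[OF T(1)]] by (auto simp: perm_grp_def mem_Auts)
      qed
      then show ?thesis using induced_in_Auts[OF inv_in_Gamma[OF T(1)]] by simp
    qed
  qed
qed

text \<open>Transitivity and the absence of blocks are transported from the pairs.\<close>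

theorem primitive_Auts: "primitive_group Flags Auts"
  unfolding primitive_group_def
proof (intro conjI allI impI)
  show "is_perm_group Flags Auts" by (rule is_perm_group_Auts)
  show "transitive_group Flags Auts"
    unfolding transitive_group_def
  proof (intro ballI)
    fix x y assume "x \<in> Flags" "y \<in> Flags"
    then obtain e f where ef: "e \<in> Pairs" "x = flag_of_pair e" "f \<in> Pairs" "y = flag_of_pair f" by (meson Flags_cases)
    obtain S where S: "S \<in> \<Gamma>" "act S ` e0 = e" using ef(1) by (rule Pairs_transitive)
    obtain T where T: "T \<in> \<Gamma>" "act T ` e0 = f" using ef(3) by (rule Pairs_transitive)
    have S': "inv_into UNIV S \<in> \<Gamma>" using S(1) by (rule inv_in_Gamma)
    have *: "act (inv_into UNIV S) ` e = e0" using image_inv(1)[OF S(1), of e0] unfolding S(2) .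
    have "induced T (induced (inv_into UNIV S) x) = y"
      unfolding ef(2) induced_flag_of_pair[OF ef(1)] * induced_flag_of_pair[OF e0_in_Pairs] T(2) ef(4) ..
    then have "induced (T \<circ> inv_into UNIV S) x = y" unfolding induced_comp[OF T(1) S'] by simp
    then show "\<exists>g\<in>Auts. g x = y" using induced_in_Auts[OF comp_in_Gamma[OF T(1) S']] by blast
  qed
  fix R assume R: "equiv Flags R \<and> preserves_rel Auts R"
  then have eq: "equiv Flags R" by blast
  define R' where "R' = {(e, f). e \<in> Pairs \<and> f \<in> Pairs \<and> (flag_of_pair e, flag_of_pair f) \<in> R}"
  have sub: "R \<subseteq> Flags \<times> Flags" using eq by (simp add: equiv_def refl_on_def)
  have "R' = Id_on Pairs \<or> R' = Pairs \<times> Pairs"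
  proof (rule invariant_equivalence)
    show "equiv Pairs R'"
    proof (rule equivI)
      show "R' \<subseteq> Pairs \<times> Pairs" by (auto simp: R'_def)
      show "refl_on Pairs R'"
        using eq flag_of_pair_in by (auto simp: R'_def refl_on_def equiv_def)
      show "sym R'" using eq unfolding equiv_def sym_def R'_def by blast
      show "trans R'" using eq unfolding equiv_def trans_def R'_def by blast
    qed
    fix T e f assume T: "T \<in> \<Gamma>" and ef: "(e, f) \<in> R'"
    then have "(induced T (flag_of_pair e), induced T (flag_of_pair f)) \<in> R"
      using R induced_in_Auts[OF T] unfolding preserves_rel_def R'_def by blast
    then show "(act T ` e, act T ` f) \<in> R'"
      using ef image_in_Pairs[OF T] by (simp add: R'_def induced_flag_of_pair)
  qed
  then show "R = Id_on Flags \<or> R = Flags \<times> Flags"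
  proof
    assume R': "R' = Id_on Pairs"
    have "x = y" if xy: "(x, y) \<in> R" for x y
    proof -
      have "x \<in> Flags" "y \<in> Flags" using xy sub by auto
      then obtain e f where ef: "e \<in> Pairs" "x = flag_of_pair e" "f \<in> Pairs" "y = flag_of_pair f" by (meson Flags_cases)
      then have "(e, f) \<in> R'" using xy by (simp add: R'_def)
      then show ?thesis using R' ef by auto
    qed
    moreover have "(x, x) \<in> R" if "x \<in> Flags" for x using eq that by (simp add: equiv_def refl_on_def)
    ultimately have "R = Id_on Flags" using sub by (intro subset_antisym subrelI) (auto simp: Id_on_def)
    then show ?thesis ..
  next
    assume R': "R' = Pairs \<times> Pairs"
    have "(x, y) \<in> R" if xy: "x \<in> Flags" "y \<in> Flags" for x y
    proof -
      obtain e f where ef: "e \<in> Pairs" "x = flag_of_pair e" "f \<in> Pairs" "y = flag_of_pair f" using xy by (meson Flags_cases)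
      then have "(e, f) \<in> R'" using R' by blast
      then show ?thesis using ef by (simp add: R'_def)
    qed
    then have "R = Flags \<times> Flags" using sub by auto
    then show ?thesis ..
  qed
qed

section \<open>Folding onto a butterfly\<close>

definition fold_code :: "code \<times> code \<Rightarrow> code \<times> code" where
  "fold_code l = the (map_of fold_table l)"

definition fold_map :: "tc_edge \<Rightarrow> tc_edge" where
  "fold_map x = flag_of (fold_code (inv_into (set pair_codes) flag_of x))"

lemma distinct_pair_codes: "distinct pair_codes"
  using check_distinct(1) unfolding distinct_map by blast

lemma distinct_fold_table: "distinct (map fst fold_table)"
  unfolding check_fold_table(1) by (rule distinct_pair_codes)

lemma fst_fold_table: "fst ` set fold_table = set pair_codes"
  unfolding check_fold_table(1)[symmetric] set_map ..

lemma fold_code_eq: "(l, m) \<in> set fold_table \<Longrightarrow> fold_code l = m"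
  using map_of_is_SomeI[OF distinct_fold_table] by (simp add: fold_code_def)

lemma fold_code_mem:
  assumes "l \<in> set pair_codes"
  shows "(l, fold_code l) \<in> set fold_table"
proof -
  obtain m where "(l, m) \<in> set fold_table" using assms unfolding fst_fold_table[symmetric] by force
  then show ?thesis using fold_code_eq by blast
qed

lemma butterfly_pair_codes: "set butterfly \<subseteq> set pair_codes"
  using check_fold_table(4) unfolding list_all_iff List.member_iff by blast

lemma fold_code_range: "fold_code ` set pair_codes = set butterfly"
proof -
  have "fold_code ` set pair_codes = fold_code ` fst ` set fold_table" unfolding fst_fold_table ..
  also have "\<dots> = snd ` set fold_table"
    unfolding image_image by (rule image_cong[OF refl]) (auto simp: fold_code_eq)
  also have "\<dots> = set butterfly" using check_fold_table(2) unfolding set_map .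
  finally show ?thesis .
qed

lemma fold_map_flag_of: "l \<in> set pair_codes \<Longrightarrow> fold_map (flag_of l) = flag_of (fold_code l)"
  by (simp add: fold_map_def bij_betw_inv_into_left[OF flag_of_bij_Flags])

lemma flag_of_eq_iff: "l \<in> set pair_codes \<Longrightarrow> m \<in> set pair_codes \<Longrightarrow> flag_of l = flag_of m \<longleftrightarrow> l = m"
  using inj_on_eq_iff[OF bij_betw_imp_inj_on[OF flag_of_bij_Flags]] .

lemma Flags_pair_codes: "Flags = flag_of ` set pair_codes"
  using bij_betw_imp_surj_on[OF flag_of_bij_Flags] by simp

lemma card_Flags: "card Flags = 45"
proof -
  have "card (set pair_codes) = length pair_codes"
    using distinct_pair_codes by (rule distinct_card)
  then show ?thesis using bij_betw_same_card[OF flag_of_bij_Flags] check_fold_table(3) by simp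
qed

definition fibre :: "code \<times> code \<Rightarrow> tc_edge set" where
  "fibre b = {x \<in> Flags. fold_map x = flag_of b}"

lemma fold_map_image: "fold_map ` Flags = flag_of ` set butterfly"
proof -
  have "fold_map ` Flags = (\<lambda>l. flag_of (fold_code l)) ` set pair_codes"
    unfolding Flags_pair_codes image_image by (rule image_cong) (simp_all add: fold_map_flag_of)
  also have "\<dots> = flag_of ` set butterfly" unfolding fold_code_range[symmetric] image_image ..
  finally show ?thesis .
qed

lemma map_kernel_fold_map: "map_kernel Flags fold_map = fibre ` set butterfly"
  unfolding map_kernel_def fold_map_image fibre_def by blast

lemma card_fibre:
  assumes "b \<in> set butterfly"
  shows "card (fibre b) = length (filter (\<lambda>(l, m). m = b) fold_table)"
proof -
  have b: "b \<in> set pair_codes" using assms butterfly_pair_codes by blast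
  have "fold_map (flag_of l) = flag_of b \<longleftrightarrow> fold_code l = b" if "l \<in> set pair_codes" for l
  proof -
    have "fold_code l \<in> set pair_codes" using fold_code_range butterfly_pair_codes that by blast
    then show ?thesis unfolding fold_map_flag_of[OF that] using b by (rule flag_of_eq_iff)
  qed
  then have "{l \<in> set pair_codes. fold_map (flag_of l) = flag_of b} = {l \<in> set pair_codes. fold_code l = b}" by blast
  moreover have "fibre b = flag_of ` {l \<in> set pair_codes. fold_map (flag_of l) = flag_of b}"
    unfolding fibre_def Flags_pair_codes by blast
  ultimately have "fibre b = flag_of ` {l \<in> set pair_codes. fold_code l = b}" by (simp only:)
  moreover have "inj_on flag_of {l \<in> set pair_codes. fold_code l = b}"
    by (rule inj_on_subset[OF bij_betw_imp_inj_on[OF flag_of_bij_Flags]]) blast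
  ultimately have "card (fibre b) = card {l \<in> set pair_codes. fold_code l = b}" by (simp add: card_image)
  also have "{l \<in> set pair_codes. fold_code l = b} = fst ` set (filter (\<lambda>(l, m). m = b) fold_table)"
  proof
    show "{l \<in> set pair_codes. fold_code l = b} \<subseteq> fst ` set (filter (\<lambda>(l, m). m = b) fold_table)"
    proof
      fix l assume "l \<in> {l \<in> set pair_codes. fold_code l = b}"
      then have l: "l \<in> set pair_codes" "fold_code l = b" by blast+
      then have "(l, b) \<in> set (filter (\<lambda>(l, m). m = b) fold_table)" using fold_code_mem[OF l(1)] by simp
      then show "l \<in> fst ` set (filter (\<lambda>(l, m). m = b) fold_table)" by force
    qed
    show "fst ` set (filter (\<lambda>(l, m). m = b) fold_table) \<subseteq> {l \<in> set pair_codes. fold_code l = b}"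
      using fst_fold_table by (auto simp: fold_code_eq)
  qed
  also have "\<dots> = set (map fst (filter (\<lambda>(l, m). m = b) fold_table))" by simp
  also have "card \<dots> = length (map fst (filter (\<lambda>(l, m). m = b) fold_table))"
    by (rule distinct_card) (rule distinct_map_filter[OF distinct_fold_table])
  finally show ?thesis by simp
qed

lemma card_fibres: "map (\<lambda>b. card (fibre b)) butterfly = [15, 5, 5, 10, 10]"
proof -
  have "map (\<lambda>b. card (fibre b)) butterfly = map (\<lambda>b. length (filter (\<lambda>(l, m). m = b) fold_table)) butterfly"
    by (rule map_cong[OF refl card_fibre])
  then show ?thesis unfolding check_count .
qed

lemma kernel_type_fold_map: "kernel_type Flags fold_map = {#5, 5, 10, 10, 15#}"
proof -
  have ne: "fibre b \<noteq> {}" if "b \<in> set butterfly" for b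
  proof -
    have "flag_of b \<in> fold_map ` Flags" unfolding fold_map_image using that by blast
    then show ?thesis by (auto simp: fibre_def)
  qed
  have "inj_on fibre (set butterfly)"
  proof (rule inj_onI)
    fix b c assume bc: "b \<in> set butterfly" "c \<in> set butterfly" "fibre b = fibre c"
    then obtain x where "x \<in> fibre b" "x \<in> fibre c" using ne by blast
    then have "flag_of b = flag_of c" by (simp add: fibre_def)
    then show "b = c" using flag_of_eq_iff butterfly_pair_codes bc(1,2) by blast
  qed
  then have "mset_set (map_kernel Flags fold_map) = image_mset fibre (mset_set (set butterfly))"
    unfolding map_kernel_fold_map by (simp add: image_mset_mset_set)
  also have "mset_set (set butterfly) = mset butterfly" using check_distinct(3) by (rule mset_set_set)
  finally have "kernel_type Flags fold_map = mset (map (\<lambda>b. card (fibre b)) butterfly)"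
    by (simp add: kernel_type_def image_mset.compositionality comp_def)
  then show ?thesis unfolding card_fibres by simp
qed

lemma non_uniform_fold_map: "non_uniform Flags fold_map"
proof -
  have "card ` map_kernel Flags fold_map = set (map (\<lambda>b. card (fibre b)) butterfly)"
    unfolding map_kernel_fold_map by (simp add: image_image)
  then have "15 \<in> card ` map_kernel Flags fold_map" "5 \<in> card ` map_kernel Flags fold_map"
    unfolding card_fibres by simp_all
  then obtain A B where AB: "A \<in> map_kernel Flags fold_map" "15 = card A" "B \<in> map_kernel Flags fold_map" "5 = card B"
    by (elim imageE)
  have "card A \<noteq> card B" unfolding AB(2,4)[symmetric] by simp
  then show ?thesis unfolding non_uniform_def using AB(1,3) by blast
qed

lemma map_rank_fold_map: "map_rank Flags fold_map = 5"
proof -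
  have "inj_on flag_of (set butterfly)"
    using bij_betw_imp_inj_on[OF flag_of_bij_Flags] butterfly_pair_codes by (rule inj_on_subset)
  then have "map_rank Flags fold_map = card (set butterfly)" by (simp add: map_rank_def fold_map_image card_image)
  also have "\<dots> = length butterfly" using check_distinct(3) by (rule distinct_card)
  finally show ?thesis by (simp add: butterfly_def)
qed

lemma fold_map_in: "fold_map \<in> Flags \<rightarrow> Flags"
proof (rule funcsetI)
  fix x assume "x \<in> Flags"
  then have "fold_map x \<in> flag_of ` set butterfly" unfolding fold_map_image[symmetric] by (rule imageI)
  then show "fold_map x \<in> Flags" unfolding Flags_pair_codes using butterfly_pair_codes by blast
qed

lemma check_endo_imp:
  assumes "(l, l') \<in> set fold_table" "(m, m') \<in> set fold_table" "code_adj l m"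
  shows "code_adj l' m'"
proof -
  let ?g = "\<lambda>(l, m). (pair_form l, pair_form m)"
  have "(pair_form l, pair_form l') \<in> set (map ?g fold_table)" "(pair_form m, pair_form m') \<in> set (map ?g fold_table)"
    unfolding set_map using assms(1,2) by (auto intro: rev_image_eqI)
  then show ?thesis using check_endo assms(3) unfolding list_all_iff code_adj_def by blast
qed

lemma fold_map_adj:
  assumes "adj x y" shows "adj (fold_map x) (fold_map y)"
proof -
  have "x \<in> Flags" "y \<in> Flags" using assms by (simp_all add: adj_iff)
  then obtain l m where lm: "l \<in> set pair_codes" "x = flag_of l" "m \<in> set pair_codes" "y = flag_of m"
    unfolding Flags_pair_codes by blast
  have st: "fold_code l \<in> set pair_codes" "fold_code m \<in> set pair_codes" using lm fold_code_range butterfly_pair_codes by blast+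
  have "code_adj l m" using assms lm adj_flag_of by simp
  then have "code_adj (fold_code l) (fold_code m)"
    using check_endo_imp[OF fold_code_mem[OF lm(1)] fold_code_mem[OF lm(3)]] by blast
  then show ?thesis using lm st by (simp add: fold_map_flag_of adj_flag_of)
qed

text \<open>Every element of the generated semigroup maps adjacent vertices to adjacent vertices, and these
  are different. A constant map would send the adjacent pairs \<open>{\<infinity>, 0}\<close> and \<open>{1,
  -1}\<close> to one vertex.\<close>

lemma not_synchronizes_fold_map: "\<not> synchronizes Flags Auts fold_map"
proof
  assume "synchronizes Flags Auts fold_map"
  then obtain t c where t: "t \<in> semigroup_gen (insert fold_map Auts)" and const: "\<And>x. x \<in> Flags \<Longrightarrow> t x = c"
    unfolding synchronizes_def by blast
  from t have endo: "adj x y \<Longrightarrow> adj (t x) (t y)" for x y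
  proof (induction arbitrary: x y)
    case (gen s)
    show ?case
    proof (cases "s = fold_map")
      case True
      then show ?thesis using fold_map_adj gen.prems by simp
    next
      case False
      then have "s \<in> Auts" using gen.hyps by simp
      moreover have "x \<in> Flags" "y \<in> Flags" using gen.prems by (simp_all add: adj_iff)
      ultimately show ?thesis using gen.prems unfolding mem_Auts by blast
    qed
  next
    case (comp s t)
    then show ?case by simp
  qed
  have "conjugate e0 {Some 1, Some (- 1)}"
    unfolding conjugate_e0_Some using gf9_neq_minus[of 1] by simp
  moreover from this have "{Some 1, Some (- 1 :: gf9)} \<in> Pairs" using conjugate_in_Pairs by blast
  ultimately have a: "adj (flag_of_pair e0) (flag_of_pair {Some 1, Some (- 1)})" using adj_flag_of_pair[OF e0_in_Pairs] by blast
  then have "adj c c" using endo[OF a] const by (simp add: adj_iff)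
  then show False by (simp add: adj_iff)
qed

theorem mainTheorem4:
  shows "let \<Omega> = sverts (line_graph Tutte_Coxeter); G = graph_aut (line_graph Tutte_Coxeter) in
    card \<Omega> = 45 \<and> primitive_group \<Omega> G \<and>
    perm_grp G \<cong> (PGammaL :: (gf9 ^ 2 \<Rightarrow> gf9 ^ 2) set monoid) \<and>
    (\<exists>f \<in> \<Omega> \<rightarrow> \<Omega>. non_uniform \<Omega> f \<and> map_rank \<Omega> f = 5 \<and>
       kernel_type \<Omega> f = {#5, 5, 10, 10, 15#} \<and> \<not> synchronizes \<Omega> G f)"
  unfolding Let_def Flags_def[symmetric] Auts_def[symmetric]
  using card_Flags primitive_Auts perm_grp_Auts_iso fold_map_in non_uniform_fold_map map_rank_fold_map kernel_type_fold_map
    not_synchronizes_fold_map by blast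

end
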